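(* Let $X$ be a non-empty topological space that is homeomorphic to a closed subspace of a Cartesian product of metrizable spaces, and let $F_{\rm top}(X)$ be the free topological group on $X$. Then $\operatorname{asdim}(F_{\rm top}(X)) = 1$.
   Context: Free topological group: for a topological space $X$, a free topological group on $X$ is a pair $(F_{\rm top}(X), i)$ consisting of a Hausdorff topological group $F_{\rm top}(X)$ and a continuous map $i\colon X\to F_{\rm top}(X)$ such that for every continuous map $f\colon X\to H$ to a Hausdorff topological group $H$ there is a unique continuous homomorphism $F\colon F_{\rm top}(X)\to H$ with $f=F\circ i$. It exists for every Tychonoff space $X$ and is unique up to unique isomorphism; moreover, for Tychonoff $X$, $i$ is a topological embedding and the underlying abstract group is free on $i(X)$. Coarse structure: a coarse structure on a set $Y$ is a collection $\mathcal{E}$ of subsets of $Y\times Y$ (entourages) that contains the diagonal and is closed under subsets, finite unions, inverses $E^{-1}=\{(y,x) : (x,y)\in E\}$ and compositions $E_1\circ E_2=\{(x,z) : \exists y,\ (x,y)\in E_1,\ (y,z)\in E_2\}$. Group-compact coarse structure: for a Hausdorff topological group $G$, it is $\mathcal{E}_{\mathcal{C}(G)}=\{E\subset G\times G : E\subset G(K\times K) \text{ for some compact } K\subset G\}$, where $G(K\times K)=\{(ga,gb) : g\in G,\ a,b\in K\}$. Asymptotic dimension: for a coarse space $(Y,\mathcal{E})$ and an integer $n\ge 0$, $\operatorname{asdim}(Y,\mathcal{E})\le n$ means that for every $L\in\mathcal{E}$ there is a cover $\mathcal{U}=\mathcal{U}_0\cup\dots\cup\mathcal{U}_n$ of $Y$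 such that each $\mathcal{U}_i$ is $L$-disjoint (for all $A\ne B$ in $\mathcal{U}_i$, $(A\times B)\cap L=\emptyset$) and $\mathcal{U}$ is uniformly bounded (there is $M\in\mathcal{E}$ with $A\times A\subset M$ for all $A\in\mathcal{U}$). $\operatorname{asdim}(Y,\mathcal{E})$ is the least such $n$, or $\infty$ if there is none. For a Hausdorff topological group $G$, $\operatorname{asdim}(G):=\operatorname{asdim}(G,\mathcal{E}_{\mathcal{C}(G)})$. *)

theory Defs
  imports "HOL-Analysis.Analysis" "HOL-Algebra.Generated_Groups" "HOL-Library.Extended_Nat"
begin

section \<open>Coarse structures and asymptotic dimension\<close>

definition coarse_structure :: "'a set \<Rightarrow> ('a \<times> 'a) set set \<Rightarrow> bool" where
  "coarse_structure Y \<E> \<longleftrightarrow>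
     \<E> \<subseteq> Pow (Y \<times> Y) \<and> Id_on Y \<in> \<E> \<and>
     (\<forall>E\<in>\<E>. \<forall>D. D \<subseteq> E \<longrightarrow> D \<in> \<E>) \<and>
     (\<forall>D\<in>\<E>. \<forall>E\<in>\<E>. D \<union> E \<in> \<E>) \<and>
     (\<forall>E\<in>\<E>. E\<inverse> \<in> \<E>) \<and>
     (\<forall>D\<in>\<E>. \<forall>E\<in>\<E>. D O E \<in> \<E>)"

definition asdim_le :: "'a set \<Rightarrow> ('a \<times> 'a) set set \<Rightarrow> nat \<Rightarrow> bool" where
  "asdim_le Y \<E> n \<longleftrightarrow>
     (\<forall>L\<in>\<E>. \<exists>\<U> :: nat \<Rightarrow> 'a set set.
        (\<Union>i\<le>n. \<Union>(\<U> i)) = Y \<and>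
        (\<forall>i\<le>n. \<forall>A\<in>\<U> i. \<forall>B\<in>\<U> i. A \<noteq> B \<longrightarrow> (A \<times> B) \<inter> L = {}) \<and>
        (\<exists>M\<in>\<E>. \<forall>i\<le>n. \<forall>A\<in>\<U> i. A \<times> A \<subseteq> M))"

definition asdim :: "'a set \<Rightarrow> ('a \<times> 'a) set set \<Rightarrow> enat" where
  "asdim Y \<E> = (if \<exists>n. asdim_le Y \<E> n then enat (LEAST n. asdim_le Y \<E> n) else \<infinity>)"


section \<open>Topological groups\<close>

definition topological_group :: "'g monoid \<Rightarrow> 'g topology \<Rightarrow> bool" where
  "topological_group G T \<longleftrightarrow>
     group G \<and> topspace T = carrier G \<and>
     continuous_map (prod_topology T T) T (\<lambda>(x, y). x \<otimes>\<^bsub>G\<^esub> y) \<and>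
     continuous_map T T (\<lambda>x. inv\<^bsub>G\<^esub> x)"

definition group_compact_coarse :: "'g monoid \<Rightarrow> 'g topology \<Rightarrow> ('g \<times> 'g) set set" where
  "group_compact_coarse G T =
     {E. \<exists>K. compactin T K \<and>
        E \<subseteq> {(g \<otimes>\<^bsub>G\<^esub> a, g \<otimes>\<^bsub>G\<^esub> b) | g a b. g \<in> carrier G \<and> a \<in> K \<and> b \<in> K}}"

lemma coarse_structure_group_compact:
  assumes "topological_group G T"
  shows "coarse_structure (carrier G) (group_compact_coarse G T)"
proof -
  interpret group G using assms by (simp add: topological_group_def)
  have T: "topspace T = carrier G"
    and cm: "continuous_map (prod_topology T T) T (\<lambda>(x, y). x \<otimes>\<^bsub>G\<^esub> y)"
    and ci: "continuous_map T T (\<lambda>x. inv\<^bsub>G\<^esub> x)"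
    using assms by (auto simp: topological_group_def)
  define B where
    "B K = {(g \<otimes>\<^bsub>G\<^esub> a, g \<otimes>\<^bsub>G\<^esub> b) | g a b. g \<in> carrier G \<and> a \<in> K \<and> b \<in> K}" for K
  have mem: "E \<in> group_compact_coarse G T \<longleftrightarrow> (\<exists>K. compactin T K \<and> E \<subseteq> B K)" for E
    by (simp add: group_compact_coarse_def B_def)
  have sub: "K \<subseteq> carrier G" if "compactin T K" for K
    using compactin_subset_topspace[OF that] T by simp
  have mono: "B K \<subseteq> B K'" if "K \<subseteq> K'" for K K'
    using that unfolding B_def by blast
  have mult: "compactin T ((\<lambda>(x, y). x \<otimes>\<^bsub>G\<^esub> y) ` (K \<times> K'))"
    if "compactin T K" "compactin T K'" for K K'
    using image_compactin[OF _ cm, of "K \<times> K'"] that by (simp add: compactin_Times)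
  have 1: "E \<subseteq> carrier G \<times> carrier G" if "E \<in> group_compact_coarse G T" for E
    using that sub unfolding mem B_def by blast
  have 2: "Id_on (carrier G) \<in> group_compact_coarse G T"
    unfolding mem
  proof (intro exI conjI)
    show "compactin T {\<one>\<^bsub>G\<^esub>}" using T by simp
    show "Id_on (carrier G) \<subseteq> B {\<one>\<^bsub>G\<^esub>}"
      unfolding B_def by (force simp: Id_on_def)
  qed
  have 3: "D \<in> group_compact_coarse G T"
    if "E \<in> group_compact_coarse G T" "D \<subseteq> E" for D E
    using that unfolding mem by blast
  have 4: "D \<union> E \<in> group_compact_coarse G T"
    if DE: "D \<in> group_compact_coarse G T" "E \<in> group_compact_coarse G T" for D E
  proof -
    obtain K K' where "compactin T K" "D \<subseteq> B K" "compactin T K'" "E \<subseteq> B K'"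
      using DE unfolding mem by blast
    then have "compactin T (K \<union> K')" "D \<union> E \<subseteq> B (K \<union> K')"
      using mono[of K "K \<union> K'"] mono[of K' "K \<union> K'"] by (auto intro: compactin_Un)
    then show ?thesis unfolding mem by blast
  qed
  have 5: "E\<inverse> \<in> group_compact_coarse G T" if E: "E \<in> group_compact_coarse G T" for E
  proof -
    have "(B K)\<inverse> \<subseteq> B K" for K unfolding B_def by blast
    then show ?thesis using E unfolding mem by blast
  qed
  have 6: "D O E \<in> group_compact_coarse G T"
    if DE: "D \<in> group_compact_coarse G T" "E \<in> group_compact_coarse G T" for D E
  proof -
    obtain K K' where K: "compactin T K" "D \<subseteq> B K" and K': "compactin T K'" "E \<subseteq> B K'"
      using DE unfolding mem by blast
    let ?m = "\<lambda>(x, y). x \<otimes>\<^bsub>G\<^esub> y"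
    define P where "P = ?m ` (?m ` (K \<times> (\<lambda>x. inv\<^bsub>G\<^esub> x) ` K') \<times> K')"
    have P: "compactin T P"
      unfolding P_def by (intro mult K K' image_compactin[OF K'(1) ci])
    have "D O E \<subseteq> B (K \<union> P)"
    proof clarify
      fix x y z assume "(x, y) \<in> D" "(y, z) \<in> E"
      then have xy: "(x, y) \<in> B K" and yz: "(y, z) \<in> B K'" using K(2) K'(2) by auto
      obtain g a b where
        g: "g \<in> carrier G" "a \<in> K" "b \<in> K" "x = g \<otimes>\<^bsub>G\<^esub> a" "y = g \<otimes>\<^bsub>G\<^esub> b"
        using xy unfolding B_def by auto
      obtain h c d where
        h: "h \<in> carrier G" "c \<in> K'" "d \<in> K'" "y = h \<otimes>\<^bsub>G\<^esub> c" "z = h \<otimes>\<^bsub>G\<^esub> d"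
        using yz unfolding B_def by auto
      have car: "b \<in> carrier G" "c \<in> carrier G" "d \<in> carrier G"
        using sub[OF K(1)] sub[OF K'(1)] g h by auto
      have "h = g \<otimes>\<^bsub>G\<^esub> b \<otimes>\<^bsub>G\<^esub> inv\<^bsub>G\<^esub> c"
        using g h car by (metis inv_solve_right m_closed)
      then have "z = g \<otimes>\<^bsub>G\<^esub> (b \<otimes>\<^bsub>G\<^esub> inv\<^bsub>G\<^esub> c \<otimes>\<^bsub>G\<^esub> d)"
        using g(1) h(5) car by (simp add: m_assoc)
      moreover have "b \<otimes>\<^bsub>G\<^esub> inv\<^bsub>G\<^esub> c \<otimes>\<^bsub>G\<^esub> d \<in> P"
        unfolding P_def using g h by force
      ultimately show "(x, z) \<in> B (K \<union> P)"
        unfolding B_def using g by blast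
    qed
    moreover have "compactin T (K \<union> P)" using K(1) P by (rule compactin_Un)
    ultimately show ?thesis unfolding mem by blast
  qed
  show ?thesis
    unfolding coarse_structure_def
    by (intro conjI ballI allI impI subsetI PowI 2 4 5 6) (use 1 3 in blast)+
qed

definition asdim_group :: "'g monoid \<Rightarrow> 'g topology \<Rightarrow> enat" where
  "asdim_group G T = asdim (carrier G) (group_compact_coarse G T)"


section \<open>Free topological groups\<close>

text \<open>
  The universal property, tested on Hausdorff topological groups whose elements have type
  \<open>'h\<close>. Homomorphisms are taken extensional, so that uniqueness means
  uniqueness on the carrier.
\<close>

definition free_top_universal ::
  "'a topology \<Rightarrow> 'g monoid \<Rightarrow> 'g topology \<Rightarrow> ('a \<Rightarrow> 'g) \<Rightarrow> 'h itself \<Rightarrow> bool" where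
  "free_top_universal X G T i (_ :: 'h itself) \<longleftrightarrow>
     (\<forall>(H :: 'h monoid) S f.
        topological_group H S \<longrightarrow> Hausdorff_space S \<longrightarrow> continuous_map X S f \<longrightarrow>
        (\<exists>!F. F \<in> hom G H \<and> F \<in> extensional (carrier G) \<and> continuous_map T S F \<and>
              (\<forall>x\<in>topspace X. F (i x) = f x)))"

text \<open>
  HOL cannot quantify over types inside a formula, so the definition tests one type, which is
  large enough: it contains a copy of \<open>'g\<close> and of the set of words in the letters
  \<open>x\<close> and \<open>x\<inverse>\<close>, hence of every group generated by an image of \<open>X\<close>.
  The lemma \<open>free_topological_group_universal\<close> below derives the universal property for
  Hausdorff topological groups over an arbitrary type.
\<close>

definition free_topological_group ::
  "'a topology \<Rightarrow> 'g monoid \<Rightarrow> 'g topology \<Rightarrow> ('a \<Rightarrow> 'g) \<Rightarrow> bool" where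
  "free_topological_group X G T i \<longleftrightarrow>
     topological_group G T \<and> Hausdorff_space T \<and> continuous_map X T i \<and>
     free_top_universal X G T i TYPE('g + ('a \<times> bool) list)"

lemma topological_group_transport:
  fixes H :: "'h monoid" and \<phi> :: "'h \<Rightarrow> 'k"
  assumes H: "topological_group H S" "Hausdorff_space S" and inj: "inj_on \<phi> (carrier H)"
  obtains H' :: "'k monoid" and S' \<psi> where
    "topological_group H' S'" "Hausdorff_space S'"
    "\<phi> \<in> hom H H'" "continuous_map S S' \<phi>"
    "\<psi> \<in> hom H' H" "continuous_map S' S \<psi>"
    "\<And>x. x \<in> carrier H \<Longrightarrow> \<psi> (\<phi> x) = x"
proof -
  interpret group H using H by (simp add: topological_group_def)
  have S: "topspace S = carrier H"
    and cm: "continuous_map (prod_topology S S) S (\<lambda>(x, y). x \<otimes>\<^bsub>H\<^esub> y)"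
    and ci: "continuous_map S S (\<lambda>x. inv\<^bsub>H\<^esub> x)"
    using H by (auto simp: topological_group_def)
  define \<psi> where "\<psi> = inv_into (carrier H) \<phi>"
  define C where "C = \<phi> ` carrier H"
  define H' :: "'k monoid" where
    "H' = \<lparr>carrier = C, mult = (\<lambda>x y. \<phi> (\<psi> x \<otimes>\<^bsub>H\<^esub> \<psi> y)), one = \<phi> \<one>\<^bsub>H\<^esub>\<rparr>"
  define S' where "S' = pullback_topology C \<psi> S"
  have l: "\<psi> (\<phi> x) = x" if "x \<in> carrier H" for x
    using that inj by (simp add: \<psi>_def)
  have r: "\<phi> (\<psi> y) = y" "\<psi> y \<in> carrier H" if "y \<in> C" for y
    using that by (auto simp: \<psi>_def C_def f_inv_into_f inv_into_into)
  have \<phi>C: "\<phi> x \<in> C" if "x \<in> carrier H" for x using that by (simp add: C_def)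
  have S': "topspace S' = C"
    using r by (auto simp: S'_def topspace_pullback_topology S)
  have simps: "carrier H' = C" "x \<otimes>\<^bsub>H'\<^esub> y = \<phi> (\<psi> x \<otimes>\<^bsub>H\<^esub> \<psi> y)" "\<one>\<^bsub>H'\<^esub> = \<phi> \<one>\<^bsub>H\<^esub>" for x y
    by (simp_all add: H'_def)
  have grp: "group H'"
  proof (rule groupI)
    fix x assume "x \<in> carrier H'"
    then show "\<exists>y\<in>carrier H'. y \<otimes>\<^bsub>H'\<^esub> x = \<one>\<^bsub>H'\<^esub>"
      by (intro bexI[of _ "\<phi> (inv\<^bsub>H\<^esub> \<psi> x)"]) (simp_all add: simps l r \<phi>C)
  qed (simp_all add: simps l r \<phi>C m_assoc)
  have \<phi>hom: "\<phi> \<in> hom H H'" by (simp add: hom_def simps l \<phi>C)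
  have \<psi>hom: "\<psi> \<in> hom H' H" by (auto simp: hom_def simps l r)
  have c\<psi>: "continuous_map S' S \<psi>"
    using continuous_map_pullback[OF continuous_map_id, of C \<psi> S] by (simp add: S'_def)
  have c\<phi>: "continuous_map S S' \<phi>"
    unfolding S'_def
  proof (rule continuous_map_pullback')
    show "continuous_map S S (\<psi> \<circ> \<phi>)"
      by (rule continuous_map_eq[OF continuous_map_id]) (simp add: S l)
    show "topspace S \<subseteq> \<phi> -` C" by (auto simp: S \<phi>C)
  qed
  have "continuous_map (prod_topology S' S') S' (\<lambda>(x, y). x \<otimes>\<^bsub>H'\<^esub> y)"
  proof -
    have "continuous_map (prod_topology S' S') (prod_topology S S) (\<lambda>(x, y). (\<psi> x, \<psi> y))"
      using c\<psi> by (simp add: continuous_map_prod_top)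
    from continuous_map_compose[OF continuous_map_compose[OF this cm] c\<phi>]
    show ?thesis by (simp add: simps comp_def case_prod_unfold)
  qed
  moreover have "continuous_map S' S' (\<lambda>x. inv\<^bsub>H'\<^esub> x)"
  proof (rule continuous_map_eq)
    show "continuous_map S' S' (\<phi> \<circ> ((\<lambda>x. inv\<^bsub>H\<^esub> x) \<circ> \<psi>))"
      by (rule continuous_map_compose[OF continuous_map_compose[OF c\<psi> ci] c\<phi>])
    fix x assume "x \<in> topspace S'"
    then have x: "x \<in> C" by (simp add: S')
    then have "\<phi> (inv\<^bsub>H\<^esub> \<psi> x) \<otimes>\<^bsub>H'\<^esub> x = \<one>\<^bsub>H'\<^esub>" by (simp add: simps l r)
    then show "(\<phi> \<circ> ((\<lambda>x. inv\<^bsub>H\<^esub> x) \<circ> \<psi>)) x = inv\<^bsub>H'\<^esub> x"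
      using group.inv_equality[OF grp] x r \<phi>C by (simp add: simps)
  qed
  ultimately have "topological_group H' S'"
    using grp S' by (simp add: topological_group_def simps)
  moreover have "Hausdorff_space S'"
  proof (rule Hausdorff_space_injective_preimage[OF H(2) c\<psi>])
    show "inj_on \<psi> (topspace S')" unfolding S' by (metis inj_onI r(1))
  qed
  ultimately show thesis using that \<phi>hom c\<phi> \<psi>hom c\<psi> l by blast
qed

lemma topological_group_subgroup:
  assumes H: "topological_group H S" and K: "subgroup K H"
  shows "topological_group (H\<lparr>carrier := K\<rparr>) (subtopology S K)"
proof -
  interpret group H using H by (simp add: topological_group_def)
  have S: "topspace S = carrier H"
    and cm: "continuous_map (prod_topology S S) S (\<lambda>(x, y). x \<otimes>\<^bsub>H\<^esub> y)"
    and ci: "continuous_map S S (\<lambda>x. inv\<^bsub>H\<^esub> x)"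
    using H by (auto simp: topological_group_def)
  have sub: "K \<subseteq> carrier H" using K by (rule subgroup.subset)
  have "continuous_map (prod_topology (subtopology S K) (subtopology S K)) (subtopology S K)
          (\<lambda>(x, y). x \<otimes>\<^bsub>H\<^esub> y)"
    unfolding continuous_map_in_subtopology
    using continuous_map_from_subtopology[OF cm, of "K \<times> K"] subgroup.m_closed[OF K]
    by (auto simp: subtopology_Times)
  moreover have "continuous_map (subtopology S K) (subtopology S K) (\<lambda>x. inv\<^bsub>H\<lparr>carrier := K\<rparr>\<^esub> x)"
  proof (rule continuous_map_eq)
    show "continuous_map (subtopology S K) (subtopology S K) (\<lambda>x. inv\<^bsub>H\<^esub> x)"
      unfolding continuous_map_in_subtopology
      using continuous_map_from_subtopology[OF ci, of K] subgroup.m_inv_closed[OF K] by auto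
  qed (use m_inv_consistent[OF K] in auto)
  ultimately show ?thesis
    using subgroup_imp_group[OF K] S sub by (auto simp: topological_group_def)
qed

lemma generate_inj_words:
  fixes H :: "'h monoid" and f :: "'a \<Rightarrow> 'h"
  assumes H: "group H" and f: "f ` A \<subseteq> carrier H"
  shows "\<exists>\<phi> :: 'h \<Rightarrow> ('a \<times> bool) list. inj_on \<phi> (generate H (f ` A))"
proof -
  interpret group H by (rule H)
  define ev where
    "ev w = foldr (\<lambda>(x, b) h. (if b then f x else inv\<^bsub>H\<^esub> f x) \<otimes>\<^bsub>H\<^esub> h) w \<one>\<^bsub>H\<^esub>"
    for w :: "('a \<times> bool) list"
  have fc: "f x \<in> carrier H" if "x \<in> A" for x using f that by auto
  have ev_closed: "ev w \<in> carrier H" if "fst ` set w \<subseteq> A" for w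
    using that by (induction w) (auto simp: ev_def fc)
  have ev_append: "ev (v @ w) = ev v \<otimes>\<^bsub>H\<^esub> ev w"
    if "fst ` set v \<subseteq> A" "fst ` set w \<subseteq> A" for v w
    using that(1)
  proof (induction v)
    case Nil
    then show ?case using ev_closed[OF that(2)] by (simp add: ev_def)
  next
    case (Cons p v)
    obtain x b where p: "p = (x, b)" by (cases p)
    have ev_Cons: "ev (p # u) = (if b then f x else inv\<^bsub>H\<^esub> f x) \<otimes>\<^bsub>H\<^esub> ev u" for u
      by (simp add: ev_def p)
    have "fst ` set v \<subseteq> A" "x \<in> A" using Cons.prems by (auto simp: p)
    then show ?case
      using Cons.IH ev_closed[of v] ev_closed[OF that(2)] fc[of x]
      by (simp add: ev_Cons m_assoc)
  qed
  have "\<exists>w. fst ` set w \<subseteq> A \<and> ev w = h" if "h \<in> generate H (f ` A)" for h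
    using that
  proof induction
    case one
    show ?case by (intro exI[of _ "[]"]) (simp add: ev_def)
  next
    case (incl h)
    then obtain x where "x \<in> A" "h = f x" by blast
    then show ?case by (intro exI[of _ "[(x, True)]"]) (simp add: ev_def fc)
  next
    case (inv h)
    then obtain x where "x \<in> A" "h = f x" by blast
    then show ?case by (intro exI[of _ "[(x, False)]"]) (simp add: ev_def fc)
  next
    case (eng h1 h2)
    then obtain v w where "fst ` set v \<subseteq> A" "ev v = h1" "fst ` set w \<subseteq> A" "ev w = h2" by blast
    then show ?case by (intro exI[of _ "v @ w"]) (auto simp: ev_append)
  qed
  then obtain \<phi> where "\<And>h. h \<in> generate H (f ` A) \<Longrightarrow> ev (\<phi> h) = h" by metis
  then have "inj_on \<phi> (generate H (f ` A))" by (metis inj_onI)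
  then show ?thesis by blast
qed

lemma hom_eq_on_generate:
  assumes "group G" "group H" "F \<in> hom G H" "F' \<in> hom G H" "B \<subseteq> carrier G"
    and eq: "\<And>b. b \<in> B \<Longrightarrow> F b = F' b" and g: "g \<in> generate G B"
  shows "F g = F' g"
proof -
  interpret F: group_hom G H F using assms by (simp add: group_hom_def group_hom_axioms_def)
  interpret F': group_hom G H F' using assms by (simp add: group_hom_def group_hom_axioms_def)
  from g show ?thesis
  proof induction
    case (inv h)
    then show ?case using eq assms(5) by (metis F.hom_inv F'.hom_inv subsetD)
  next
    case (eng h1 h2)
    then show ?case
      using group.generate_in_carrier[OF assms(1) assms(5)] by (metis F.hom_mult F'.hom_mult)
  qed (use eq in auto)
qed

lemma free_topological_group_factor:
  fixes X :: "'a topology" and G :: "'g monoid" and H :: "'h monoid"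
  assumes free: "free_topological_group X G T i"
    and H: "topological_group H S" "Hausdorff_space S" and f: "continuous_map X S f"
  shows "\<exists>F. F \<in> hom G H \<and> continuous_map T S F \<and> F ` carrier G \<subseteq> generate H (f ` topspace X) \<and>
             (\<forall>x\<in>topspace X. F (i x) = f x)"
proof -
  interpret H: group H using H by (simp add: topological_group_def)
  define K where "K = generate H (f ` topspace X)"
  have S: "topspace S = carrier H" using H by (simp add: topological_group_def)
  have fX: "f ` topspace X \<subseteq> carrier H"
    using f S by (auto simp: continuous_map_def)
  have K: "subgroup K H" unfolding K_def by (rule H.generate_is_subgroup[OF fX])
  have fK: "f ` topspace X \<subseteq> K" unfolding K_def by (auto intro: generate.incl)
  obtain \<phi>0 :: "'h \<Rightarrow> ('a \<times> bool) list" where "inj_on \<phi>0 K"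
    using generate_inj_words[OF H.is_group fX] unfolding K_def by blast
  then have inj: "inj_on (Inr \<circ> \<phi>0 :: 'h \<Rightarrow> 'g + ('a \<times> bool) list) (carrier (H\<lparr>carrier := K\<rparr>))"
    by (simp add: inj_on_def)
  obtain H' :: "('g + ('a \<times> bool) list) monoid" and S' \<psi> where
    H': "topological_group H' S'" "Hausdorff_space S'"
    and \<phi>: "Inr \<circ> \<phi>0 \<in> hom (H\<lparr>carrier := K\<rparr>) H'"
      "continuous_map (subtopology S K) S' (Inr \<circ> \<phi>0)"
    and \<psi>: "\<psi> \<in> hom H' (H\<lparr>carrier := K\<rparr>)" "continuous_map S' (subtopology S K) \<psi>"
      "\<And>x. x \<in> carrier (H\<lparr>carrier := K\<rparr>) \<Longrightarrow> \<psi> ((Inr \<circ> \<phi>0) x) = x"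
    using topological_group_transport[OF topological_group_subgroup[OF H(1) K]
        Hausdorff_space_subtopology[OF H(2)] inj] by blast
  have "continuous_map X (subtopology S K) f"
    using f fK by (auto simp: continuous_map_in_subtopology)
  from continuous_map_compose[OF this \<phi>(2)] obtain F where
    F: "F \<in> hom G H'" "continuous_map T S' F"
      "\<And>x. x \<in> topspace X \<Longrightarrow> F (i x) = ((Inr \<circ> \<phi>0) \<circ> f) x"
    using free H' unfolding free_topological_group_def free_top_universal_def by metis
  have *: "\<psi> \<circ> F \<in> hom G (H\<lparr>carrier := K\<rparr>)" using hom_compose[OF F(1) \<psi>(1)] .
  have im: "(\<psi> \<circ> F) ` carrier G \<subseteq> K" using * by (auto simp: hom_def)
  have "\<psi> \<circ> F \<in> hom G H"
    using * subgroup.subset[OF K] by (auto simp: hom_def)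
  moreover have "continuous_map T S (\<psi> \<circ> F)"
    using continuous_map_compose[OF F(2) \<psi>(2)] by (simp add: continuous_map_in_subtopology)
  moreover have "(\<psi> \<circ> F) (i x) = f x" if "x \<in> topspace X" for x
    using that F(3) \<psi>(3) fK by auto
  ultimately show ?thesis using im unfolding K_def by blast
qed

lemma free_topological_group_generate:
  fixes X :: "'a topology" and G :: "'g monoid"
  assumes free: "free_topological_group X G T i"
  shows "generate G (i ` topspace X) = carrier G"
proof -
  have G: "topological_group G T" "Hausdorff_space T" and i: "continuous_map X T i"
    using free by (auto simp: free_topological_group_def)
  interpret G: group G using G by (simp add: topological_group_def)
  have T: "topspace T = carrier G" using G by (simp add: topological_group_def)
  obtain r where r: "r \<in> hom G G" "continuous_map T T r"
    "r ` carrier G \<subseteq> generate G (i ` topspace X)" "\<And>x. x \<in> topspace X \<Longrightarrow> r (i x) = i x"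
    using free_topological_group_factor[OF free G i] by blast
  have inj: "inj_on (Inl :: 'g \<Rightarrow> 'g + ('a \<times> bool) list) (carrier G)" by simp
  obtain H' :: "('g + ('a \<times> bool) list) monoid" and S' where
    H': "topological_group H' S'" "Hausdorff_space S'"
    and \<phi>: "Inl \<in> hom G H'" "continuous_map T S' Inl"
    using topological_group_transport[OF G inj] by metis
  have cX: "i x \<in> carrier G" if "x \<in> topspace X" for x
    using i T that by (auto simp: continuous_map_def)
  define P where "P F \<longleftrightarrow> F \<in> hom G H' \<and> F \<in> extensional (carrier G) \<and> continuous_map T S' F \<and>
      (\<forall>x\<in>topspace X. F (i x) = (Inl \<circ> i) x)" for F
  have uniq: "\<exists>!F. P F"
    using free H' continuous_map_compose[OF i \<phi>(2)]
    unfolding P_def free_topological_group_def free_top_universal_def by blast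
  have PI: "P (restrict F (carrier G))"
    if "F \<in> hom G H'" "continuous_map T S' F" "\<And>x. x \<in> topspace X \<Longrightarrow> F (i x) = Inl (i x)" for F
  proof -
    have "restrict F (carrier G) \<in> hom G H'"
      using that(1) by (auto simp: hom_def)
    moreover have "continuous_map T S' (restrict F (carrier G))"
      by (rule continuous_map_eq[OF that(2)]) (simp add: T)
    ultimately show ?thesis using that(3) cX by (simp add: P_def)
  qed
  have "P (restrict Inl (carrier G))" using PI[OF \<phi>] by simp
  moreover have "P (restrict (Inl \<circ> r) (carrier G))"
    using r by (intro PI hom_compose[OF r(1) \<phi>(1)] continuous_map_compose[OF r(2) \<phi>(2)]) auto
  ultimately have "(restrict Inl (carrier G) :: 'g \<Rightarrow> 'g + ('a \<times> bool) list) =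
      restrict (Inl \<circ> r) (carrier G)"
    using uniq by metis
  then have "r g = g" if "g \<in> carrier G" for g
    using that by (metis comp_apply restrict_apply' sum.inject(1))
  then have "carrier G \<subseteq> generate G (i ` topspace X)" using r(3) by force
  moreover have "generate G (i ` topspace X) \<subseteq> carrier G"
    using cX by (intro G.generate_incl) auto
  ultimately show ?thesis by blast
qed

lemma free_topological_group_universal:
  fixes X :: "'a topology" and G :: "'g monoid"
  assumes free: "free_topological_group X G T i"
  shows "free_top_universal X G T i TYPE('h)"
  unfolding free_top_universal_def
proof (intro allI impI)
  fix H :: "'h monoid" and S f
  assume H: "topological_group H S" "Hausdorff_space S" and f: "continuous_map X S f"
  have G: "group G" "topspace T = carrier G" and i: "continuous_map X T i"
    using free by (auto simp: free_topological_group_def topological_group_def)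
  have gH: "group H" using H by (simp add: topological_group_def)
  have cX: "i ` topspace X \<subseteq> carrier G" using i G by (auto simp: continuous_map_def)
  obtain F where F: "F \<in> hom G H" "continuous_map T S F" "\<And>x. x \<in> topspace X \<Longrightarrow> F (i x) = f x"
    using free_topological_group_factor[OF free H f] by blast
  show "\<exists>!F. F \<in> hom G H \<and> F \<in> extensional (carrier G) \<and> continuous_map T S F \<and>
             (\<forall>x\<in>topspace X. F (i x) = f x)"
  proof (rule ex1I)
    have "restrict F (carrier G) \<in> hom G H"
      using F(1) group.is_monoid[OF G(1)] by (auto simp: hom_def monoid.m_closed)
    moreover have "continuous_map T S (restrict F (carrier G))"
      by (rule continuous_map_eq[OF F(2)]) (simp add: G)
    ultimately show "restrict F (carrier G) \<in> hom G H \<and>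
        restrict F (carrier G) \<in> extensional (carrier G) \<and>
        continuous_map T S (restrict F (carrier G)) \<and>
        (\<forall>x\<in>topspace X. restrict F (carrier G) (i x) = f x)"
      using F(3) cX by auto
  next
    fix F' assume F': "F' \<in> hom G H \<and> F' \<in> extensional (carrier G) \<and> continuous_map T S F' \<and>
             (\<forall>x\<in>topspace X. F' (i x) = f x)"
    show "F' = restrict F (carrier G)"
    proof (rule extensionalityI)
      fix g assume g: "g \<in> carrier G"
      then have gen: "g \<in> generate G (i ` topspace X)"
        using free_topological_group_generate[OF free] by simp
      have hom: "F' \<in> hom G H" using F' by blast
      have eq: "F' b = F b" if "b \<in> i ` topspace X" for b
        using that F(3) F' by auto
      have "F' g = F g"
        by (rule hom_eq_on_generate[OF G(1) gH hom F(1) cX eq gen])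
      then show "F' g = restrict F (carrier G) g" using g by simp
    qed (use F' in auto)
  qed
qed

end

theory Submission
  imports Defs
begin

text \<open>
  Let \<open>F\<close> be the group of reduced words in the points of \<open>X\<close>, topologised by all length functions
  \<open>N\<close> such that \<open>N (g\<inverse> x\<inverse> y g) \<rightarrow> 0\<close> as \<open>y \<rightarrow> x\<close>, for all \<open>g\<close> and \<open>x\<close>. By the universal property the
  free topological group maps continuously, and bijectively, to \<open>F\<close>, so every such \<open>N\<close> is bounded
  on compact sets.

  Length functions are obtained by random rounding: a continuous \<open>q : X \<rightarrow> \<real>\<close> and a threshold
  \<open>s \<in> [0,1]\<close> send the letter \<open>x\<close> to the integer nearest to \<open>q x\<close>, or to the empty word if \<open>q x\<close> is
  too far from it, and one averages over \<open>s\<close> a weighted word length of the image in the free group on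
  the integers. If \<open>q\<close> takes distinct integral values on the letters of a word, nothing
  cancels in its image. Given a sequence \<open>w\<^sub>n\<close> in a compact set \<open>K\<close>, summing such functions with
  coefficients \<open>2\<^sup>-\<^sup>n\<close>, the \<open>n\<close>-th one adapted to \<open>w\<^sub>n\<close>, shows that the words in \<open>K\<close> have
  bounded length. With a huge weight for one letter \<open>x\<^sub>n\<close> of \<open>w\<^sub>n\<close>, which is allowed if the \<open>x\<^sub>n\<close> have a locally
  finite family of neighbourhoods, it shows that the letters occurring in \<open>K\<close> have relatively
  compact image in every metrizable space, hence lie in a compact \<open>A \<subseteq> X\<close>.

  The coarse structure is therefore the one given by the word metrics with respect to compact
  \<open>A \<subseteq> X\<close>, whose components are trees. Trees have asymptotic dimension at most one, uniformly; the powers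
  of one letter show that the dimension is not zero.
\<close>


section \<open>Reduced words\<close>

text \<open>A letter \<open>(x, True)\<close> stands for the point x and \<open>(x, False)\<close>
  for its formal inverse, so this is inversion of letters.\<close>

definition flip :: "'a \<times> bool \<Rightarrow> 'a \<times> bool" where
  "flip a = (fst a, \<not> snd a)"

definition is_reduced :: "('a \<times> bool) list \<Rightarrow> bool" where
  "is_reduced = successively (\<lambda>a b. b \<noteq> flip a)"

fun push :: "'a \<times> bool \<Rightarrow> ('a \<times> bool) list \<Rightarrow> ('a \<times> bool) list" where
  "push a [] = [a]"
| "push a (b # w) = (if b = flip a then w else a # b # w)"

definition word_inv :: "('a \<times> bool) list \<Rightarrow> ('a \<times> bool) list" where
  "word_inv w = rev (map flip w)"

text \<open>The product lets the letters of the left factor act one after the other on the right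
  factor. By \<open>push_push_flip\<close> opposite letters act on reduced words as inverse maps;
  associativity comes from this action, in the manner of van der Waerden, and not from confluence of
  cancellation.\<close>

definition free_group :: "'a set \<Rightarrow> ('a \<times> bool) list monoid" where
  "free_group S = \<lparr>carrier = {w. is_reduced w \<and> fst ` set w \<subseteq> S}, mult = foldr push, one = []\<rparr>"

lemma flip_flip [simp]: "flip (flip a) = a"
  by (simp add: flip_def)

lemma fst_flip [simp]: "fst (flip a) = fst a"
  by (simp add: flip_def)

lemma flip_neq [simp]: "flip a \<noteq> a" "a \<noteq> flip a"
  by (auto simp: flip_def prod_eq_iff)

lemma reduced_Nil [simp]: "is_reduced []"
  by (simp add: is_reduced_def)

lemma reduced_single [simp]: "is_reduced [a]"
  by (simp add: is_reduced_def)

lemma reduced_Cons_Cons [simp]: "is_reduced (a # b # w) \<longleftrightarrow> b \<noteq> flip a \<and> is_reduced (b # w)"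
  by (simp add: is_reduced_def)

lemma reduced_ConsD: "is_reduced (a # w) \<Longrightarrow> is_reduced w"
  by (cases w) auto

lemma push_reduced: "is_reduced w \<Longrightarrow> is_reduced (push a w)"
  by (cases w) (auto dest: reduced_ConsD)

lemma push_Cons_reduced: "is_reduced (a # w) \<Longrightarrow> push a w = a # w"
  by (cases w) auto

lemma push_push_flip: "is_reduced w \<Longrightarrow> push a (push (flip a) w) = w"
  by (cases w) (auto simp: push_Cons_reduced)

lemma push_flip_push: "is_reduced w \<Longrightarrow> push (flip a) (push a w) = w"
  using push_push_flip[of w "flip a"] by simp

lemma foldr_push_reduced: "is_reduced v \<Longrightarrow> is_reduced (foldr push u v)"
  by (induction u) (auto simp: push_reduced)

lemma foldr_push_push: "is_reduced w \<Longrightarrow> foldr push (push a u) w = push a (foldr push u w)"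
  by (cases u) (auto simp: push_push_flip foldr_push_reduced)

lemma foldr_push_assoc: "is_reduced w \<Longrightarrow> foldr push (foldr push u v) w = foldr push u (foldr push v w)"
  by (induction u) (auto simp: foldr_push_push)

lemma foldr_push_append_reduced: "is_reduced (u @ v) \<Longrightarrow> foldr push u v = u @ v"
proof (induction u)
  case (Cons a u)
  then show ?case using reduced_ConsD[of a "u @ v"] push_Cons_reduced[of a "u @ v"] by simp
qed simp

lemma foldr_push_Nil: "is_reduced w \<Longrightarrow> foldr push w [] = w"
  using foldr_push_append_reduced[of w "[]"] by simp

lemma word_inv_Nil [simp]: "word_inv [] = []"
  by (simp add: word_inv_def)

lemma word_inv_Cons [simp]: "word_inv (a # w) = word_inv w @ [flip a]"
  by (simp add: word_inv_def)

lemma length_word_inv [simp]: "length (word_inv w) = length w"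
  by (simp add: word_inv_def)

lemma fst_set_word_inv [simp]: "fst ` set (word_inv w) = fst ` set w"
  by (auto simp: word_inv_def image_image)

lemma word_inv_reduced: "is_reduced w \<Longrightarrow> is_reduced (word_inv w)"
  unfolding is_reduced_def word_inv_def
  by (simp add: successively_map) (metis (mono_tags, lifting) flip_flip successively_mono)

lemma foldr_push_word_inv: "is_reduced v \<Longrightarrow> foldr push (word_inv u) (foldr push u v) = v"
  by (induction u) (auto simp: push_flip_push foldr_push_reduced)

lemma set_push: "set (push a w) \<subseteq> insert a (set w)"
  by (cases w) auto

lemma set_foldr_push: "set (foldr push u v) \<subseteq> set u \<union> set v"
  using set_push by (induction u) fastforce+

lemma free_group_simps [simp]:
  "carrier (free_group S) = {w. is_reduced w \<and> fst ` set w \<subseteq> S}"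
  "u \<otimes>\<^bsub>free_group S\<^esub> v = foldr push u v"
  "\<one>\<^bsub>free_group S\<^esub> = []"
  by (simp_all add: free_group_def)

lemma group_free_group: "group (free_group S)"
proof (rule groupI)
  fix x y assume "x \<in> carrier (free_group S)" "y \<in> carrier (free_group S)"
  then show "x \<otimes>\<^bsub>free_group S\<^esub> y \<in> carrier (free_group S)"
    using image_mono[OF set_foldr_push[of x y], of fst]
    by (simp add: foldr_push_reduced image_Un) blast
next
  fix x assume x: "x \<in> carrier (free_group S)"
  then show "\<exists>y\<in>carrier (free_group S). y \<otimes>\<^bsub>free_group S\<^esub> x = \<one>\<^bsub>free_group S\<^esub>"
    using foldr_push_word_inv[of "[]" x]
    by (intro bexI[of _ "word_inv x"]) (simp_all add: foldr_push_Nil word_inv_reduced)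
qed (auto simp: foldr_push_assoc)

lemma inv_free_group: "w \<in> carrier (free_group S) \<Longrightarrow> inv\<^bsub>free_group S\<^esub> w = word_inv w"
  using foldr_push_word_inv[of "[]" w]
  by (intro group.inv_equality[OF group_free_group]) (auto simp: foldr_push_Nil word_inv_reduced)

declare free_group_simps [simp del]

text \<open>Cancellation happens only where the two words meet. In the induction a new first letter
  can cancel only if nothing of the left word has survived, because a surviving first letter is its
  neighbour in a reduced word.\<close>

lemma foldr_push_decomp:
  assumes "is_reduced u" "is_reduced v"
  obtains p s t where "u = p @ s" "v = word_inv s @ t" "foldr push u v = p @ t"
proof -
  have "\<exists>p s t. u = p @ s \<and> v = word_inv s @ t \<and> foldr push u v = p @ t"
    using assms(1)
  proof (induction u)
    case (Cons a u)
    then obtain p s t where IH: "u = p @ s" "v = word_inv s @ t" "foldr push u v = p @ t"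
      using reduced_ConsD by blast
    show ?case
    proof (cases p)
      case Nil
      show ?thesis
      proof (cases "\<exists>t'. t = flip a # t'")
        case True
        then obtain t' where "t = flip a # t'" by blast
        then show ?thesis using IH Nil
          by (intro exI[of _ "[]"] exI[of _ "a # s"] exI[of _ t']) auto
      next
        case False
        then have "push a t = a # t" by (cases t) auto
        then show ?thesis using IH Nil
          by (intro exI[of _ "[a]"] exI[of _ s] exI[of _ t]) auto
      qed
    next
      case (Cons b p')
      then have "b \<noteq> flip a" using Cons.prems IH(1) by auto
      then show ?thesis using IH Cons
        by (intro exI[of _ "a # p"] exI[of _ s] exI[of _ t]) auto
    qed
  qed auto
  then show thesis using that by blast
qed

section \<open>Evaluation of words in a group\<close>

definition free_lift :: "('h, 'm) monoid_scheme \<Rightarrow> ('a \<Rightarrow> 'h) \<Rightarrow> ('a \<times> bool) list \<Rightarrow> 'h" where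
  "free_lift H f w = foldr (\<lambda>a h. (if snd a then f (fst a) else inv\<^bsub>H\<^esub> f (fst a)) \<otimes>\<^bsub>H\<^esub> h) w \<one>\<^bsub>H\<^esub>"

lemma free_lift_Nil [simp]: "free_lift H f [] = \<one>\<^bsub>H\<^esub>"
  by (simp add: free_lift_def)

lemma free_lift_Cons [simp]:
  "free_lift H f (a # w) =
    (if snd a then f (fst a) else inv\<^bsub>H\<^esub> f (fst a)) \<otimes>\<^bsub>H\<^esub> free_lift H f w"
  by (simp add: free_lift_def)

context group
begin

lemma free_lift_closed:
  "f ` fst ` set w \<subseteq> carrier G \<Longrightarrow> free_lift G f w \<in> carrier G"
  by (induction w) auto

lemma free_lift_push:
  assumes "f ` fst ` set (a # w) \<subseteq> carrier G"
  shows "free_lift G f (push a w) = free_lift G f (a # w)"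
proof (cases w)
  case (Cons b w')
  have "free_lift G f w' \<in> carrier G" "f (fst a) \<in> carrier G"
    using assms Cons by (auto intro: free_lift_closed)
  then show ?thesis
    using Cons by (auto simp: flip_def m_assoc[symmetric])
qed auto

lemma free_lift_foldr_push:
  assumes "f ` fst ` set u \<subseteq> carrier G" "f ` fst ` set v \<subseteq> carrier G"
  shows "free_lift G f (foldr push u v) = free_lift G f u \<otimes> free_lift G f v"
  using assms(1)
proof (induction u)
  case (Cons a u)
  have "f ` fst ` set (foldr push u v) \<subseteq> carrier G"
    using set_foldr_push[of u v] Cons.prems assms(2) by (auto simp: image_subset_iff)
  then show ?case
    using Cons free_lift_closed[of f u] free_lift_closed[OF assms(2)]
      free_lift_push[of f a "foldr push u v"] by (auto simp: m_assoc)
qed (use free_lift_closed[OF assms(2)] in simp)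

lemma free_lift_hom:
  assumes "f ` S \<subseteq> carrier G"
  shows "free_lift G f \<in> hom (free_group S) G"
  unfolding hom_def
proof (intro CollectI conjI Pi_I ballI)
  fix u v assume "u \<in> carrier (free_group S)" "v \<in> carrier (free_group S)"
  then show "free_lift G f (u \<otimes>\<^bsub>free_group S\<^esub> v) = free_lift G f u \<otimes> free_lift G f v"
    using assms free_lift_foldr_push[of f u v] by (auto simp: image_subset_iff free_group_simps)
qed (use assms in \<open>auto simp: image_subset_iff free_group_simps intro!: free_lift_closed\<close>)

end

section \<open>Length functions and the topologies they define\<close>

definition length_function :: "('g, 'm) monoid_scheme \<Rightarrow> ('g \<Rightarrow> real) \<Rightarrow> bool" where
  "length_function G N \<longleftrightarrow> N \<one>\<^bsub>G\<^esub> = 0 \<and>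
     (\<forall>x\<in>carrier G. 0 \<le> N x \<and> N (inv\<^bsub>G\<^esub> x) = N x) \<and>
     (\<forall>x\<in>carrier G. \<forall>y\<in>carrier G. N (x \<otimes>\<^bsub>G\<^esub> y) \<le> N x + N y)"

definition length_topology :: "('g, 'm) monoid_scheme \<Rightarrow> ('g \<Rightarrow> real) set \<Rightarrow> 'g topology" where
  "length_topology G \<N> = topology (\<lambda>U. U \<subseteq> carrier G \<and>
     (\<forall>g\<in>U. \<exists>N\<in>\<N>. \<exists>e>0. \<forall>h\<in>carrier G. N (inv\<^bsub>G\<^esub> g \<otimes>\<^bsub>G\<^esub> h) < e \<longrightarrow> h \<in> U))"

text \<open>The topology has the left translates of single balls as basic neighbourhoods. Closure
  under sums provides for intersections of two such balls; closure under conjugation makes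
  multiplication and inversion continuous.\<close>

locale length_family = group G for G :: "'a monoid" (structure) +
  fixes \<N> :: "('a \<Rightarrow> real) set"
  assumes len: "N \<in> \<N> \<Longrightarrow> length_function G N"
    and nonempty: "\<N> \<noteq> {}"
    and add: "N \<in> \<N> \<Longrightarrow> N' \<in> \<N> \<Longrightarrow> (\<lambda>x. N x + N' x) \<in> \<N>"
    and conj: "N \<in> \<N> \<Longrightarrow> g \<in> carrier G \<Longrightarrow> (\<lambda>x. N (inv g \<otimes> x \<otimes> g)) \<in> \<N>"
begin

lemma len_one: "N \<in> \<N> \<Longrightarrow> N \<one> = 0"
  and len_nonneg: "N \<in> \<N> \<Longrightarrow> x \<in> carrier G \<Longrightarrow> 0 \<le> N x"
  and len_inv: "N \<in> \<N> \<Longrightarrow> x \<in> carrier G \<Longrightarrow> N (inv x) = N x"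
  and len_mult: "N \<in> \<N> \<Longrightarrow> x \<in> carrier G \<Longrightarrow> y \<in> carrier G \<Longrightarrow> N (x \<otimes> y) \<le> N x + N y"
  using len by (auto simp: length_function_def)

lemma openin_length_topology:
  "openin (length_topology G \<N>) U \<longleftrightarrow> U \<subseteq> carrier G \<and>
     (\<forall>g\<in>U. \<exists>N\<in>\<N>. \<exists>e>0. \<forall>h\<in>carrier G. N (inv g \<otimes> h) < e \<longrightarrow> h \<in> U)"
proof -
  let ?P = "\<lambda>U. U \<subseteq> carrier G \<and>
     (\<forall>g\<in>U. \<exists>N\<in>\<N>. \<exists>e>0. \<forall>h\<in>carrier G. N (inv g \<otimes> h) < e \<longrightarrow> h \<in> U)"
  have "?P (U \<inter> V)" if U: "?P U" and V: "?P V" for U V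
  proof (intro conjI ballI)
    fix g assume g: "g \<in> U \<inter> V"
    then have gc: "g \<in> carrier G" using U by blast
    obtain N e where N: "N \<in> \<N>" "e > 0" "\<And>h. h \<in> carrier G \<Longrightarrow> N (inv g \<otimes> h) < e \<Longrightarrow> h \<in> U"
      using U g by blast
    obtain N' e' where N': "N' \<in> \<N>" "e' > 0" "\<And>h. h \<in> carrier G \<Longrightarrow> N' (inv g \<otimes> h) < e' \<Longrightarrow> h \<in> V"
      using V g by blast
    show "\<exists>N\<in>\<N>. \<exists>e>0. \<forall>h\<in>carrier G. N (inv g \<otimes> h) < e \<longrightarrow> h \<in> U \<inter> V"
    proof (intro bexI[OF _ add[OF N(1) N'(1)]] exI[of _ "min e e'"] conjI ballI impI)
      fix h assume h: "h \<in> carrier G" "N (inv g \<otimes> h) + N' (inv g \<otimes> h) < min e e'"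
      have "0 \<le> N (inv g \<otimes> h)" "0 \<le> N' (inv g \<otimes> h)"
        using h gc N N' by (auto intro: len_nonneg)
      with h N(3) N'(3) show "h \<in> U \<inter> V" by auto
    qed (use N N' in auto)
  qed (use U in auto)
  moreover have "?P (\<Union>\<K>)" if "\<forall>K\<in>\<K>. ?P K" for \<K>
  proof (intro conjI ballI)
    fix g assume "g \<in> \<Union>\<K>"
    then obtain K where K: "K \<in> \<K>" "g \<in> K" by blast
    with that obtain N e where "N \<in> \<N>" "e > 0" "\<forall>h\<in>carrier G. N (inv g \<otimes> h) < e \<longrightarrow> h \<in> K"
      by meson
    with K(1) show "\<exists>N\<in>\<N>. \<exists>e>0. \<forall>h\<in>carrier G. N (inv g \<otimes> h) < e \<longrightarrow> h \<in> \<Union>\<K>"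
      by blast
  qed (use that in blast)
  ultimately have "istopology ?P" unfolding istopology_def by blast
  then show ?thesis unfolding length_topology_def by (simp add: topology_inverse')
qed

lemma topspace_length_topology [simp]: "topspace (length_topology G \<N>) = carrier G"
proof -
  have "openin (length_topology G \<N>) (carrier G)"
    using nonempty unfolding openin_length_topology by (auto intro: exI[of _ 1])
  then show ?thesis
    using openin_subset openin_topspace[of "length_topology G \<N>"]
    by (metis (no_types, lifting) openin_length_topology subset_antisym)
qed

lemma len_triangle:
  assumes "N \<in> \<N>" "g \<in> carrier G" "h \<in> carrier G" "k \<in> carrier G"
  shows "N (inv g \<otimes> k) \<le> N (inv g \<otimes> h) + N (inv h \<otimes> k)"
proof -
  have "inv g \<otimes> k = (inv g \<otimes> h) \<otimes> (inv h \<otimes> k)"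
    using assms by (metis inv_closed inv_solve_left m_assoc m_closed)
  then show ?thesis using len_mult[OF assms(1)] assms by simp
qed

lemma openin_length_ball:
  assumes "N \<in> \<N>" "g \<in> carrier G"
  shows "openin (length_topology G \<N>) {h \<in> carrier G. N (inv g \<otimes> h) < e}"
  unfolding openin_length_topology
proof (intro conjI ballI)
  fix h assume h: "h \<in> {h \<in> carrier G. N (inv g \<otimes> h) < e}"
  show "\<exists>N'\<in>\<N>. \<exists>e'>0. \<forall>k\<in>carrier G. N' (inv h \<otimes> k) < e' \<longrightarrow> k \<in> {h \<in> carrier G. N (inv g \<otimes> h) < e}"
  proof (intro bexI[OF _ assms(1)] exI[of _ "e - N (inv g \<otimes> h)"] conjI ballI impI)
    fix k assume "k \<in> carrier G" "N (inv h \<otimes> k) < e - N (inv g \<otimes> h)"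
    with h len_triangle[OF assms, of h k] show "k \<in> {h \<in> carrier G. N (inv g \<otimes> h) < e}" by auto
  qed (use h in auto)
qed auto

lemma continuous_map_length_topology:
  "continuous_map X (length_topology G \<N>) f \<longleftrightarrow> f \<in> topspace X \<rightarrow> carrier G \<and>
     (\<forall>x\<in>topspace X. \<forall>N\<in>\<N>. \<forall>e>0. \<exists>V. openin X V \<and> x \<in> V \<and> (\<forall>y\<in>V. N (inv (f x) \<otimes> f y) < e))"
    (is "?L \<longleftrightarrow> ?R")
proof
  assume L: ?L
  then have f: "f \<in> topspace X \<rightarrow> carrier G" by (simp add: continuous_map_def)
  moreover have "\<exists>V. openin X V \<and> x \<in> V \<and> (\<forall>y\<in>V. N (inv (f x) \<otimes> f y) < e)"
    if "x \<in> topspace X" "N \<in> \<N>" "e > 0" for x N e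
  proof (intro exI conjI ballI)
    let ?U = "{h \<in> carrier G. N (inv (f x) \<otimes> h) < e}"
    have fx: "f x \<in> carrier G" using f that by auto
    show "openin X {y \<in> topspace X. f y \<in> ?U}"
      using L openin_length_ball[OF that(2) fx, of e] unfolding continuous_map_def by blast
    show "x \<in> {y \<in> topspace X. f y \<in> ?U}"
      using that fx by (simp add: len_one)
  qed auto
  ultimately show ?R by blast
next
  assume R: ?R
  show ?L
    unfolding continuous_map_def
  proof (intro conjI allI impI)
    fix U assume U: "openin (length_topology G \<N>) U"
    show "openin X {x \<in> topspace X. f x \<in> U}"
      unfolding openin_subopen[of X "{x \<in> topspace X. f x \<in> U}"]
    proof clarify
      fix x assume x: "x \<in> topspace X" "f x \<in> U"
      then obtain N e where N: "N \<in> \<N>" "e > 0" "\<forall>h\<in>carrier G. N (inv (f x) \<otimes> h) < e \<longrightarrow> h \<in> U"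
        using U unfolding openin_length_topology by meson
      then obtain V where V: "openin X V" "x \<in> V" "\<forall>y\<in>V. N (inv (f x) \<otimes> f y) < e"
        using R x by meson
      then have "V \<subseteq> {x \<in> topspace X. f x \<in> U}"
      proof (intro subsetI CollectI conjI)
        fix y assume y: "y \<in> V"
        then show yX: "y \<in> topspace X" using openin_subset[OF V(1)] by blast
        then have "f y \<in> carrier G" using R by auto
        then show "f y \<in> U" using N(3) V(3) y by blast
      qed
      with V show "\<exists>V. openin X V \<and> x \<in> V \<and> V \<subseteq> {x \<in> topspace X. f x \<in> U}" by blast
    qed
  qed (use R in auto)
qed

lemma topological_group_length_topology: "topological_group G (length_topology G \<N>)"
proof -
  let ?T = "length_topology G \<N>"
  have "continuous_map (prod_topology ?T ?T) ?T (\<lambda>(x, y). x \<otimes> y)"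
    unfolding continuous_map_length_topology
  proof (intro conjI ballI allI impI)
    fix p N and e :: real assume p: "p \<in> topspace (prod_topology ?T ?T)" and N: "N \<in> \<N>" and e: "e > 0"
    obtain g h where gh: "p = (g, h)" "g \<in> carrier G" "h \<in> carrier G" using p by auto
    \<comment> \<open>The conjugated length takes care of the factor h, since (g h)^-1 (g' h') is
      the product of h^-1 (g^-1 g') h and h^-1 h'.\<close>
    let ?N' = "\<lambda>x. N (inv h \<otimes> x \<otimes> h)"
    let ?U = "{g' \<in> carrier G. ?N' (inv g \<otimes> g') < e/2}" and ?V = "{h' \<in> carrier G. N (inv h \<otimes> h') < e/2}"
    have N': "?N' \<in> \<N>" using conj[OF N gh(3)] .
    show "\<exists>V. openin (prod_topology ?T ?T) V \<and> p \<in> V \<and>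
        (\<forall>q\<in>V. N (inv (case p of (x, y) \<Rightarrow> x \<otimes> y) \<otimes> (case q of (x, y) \<Rightarrow> x \<otimes> y)) < e)"
    proof (intro exI[of _ "?U \<times> ?V"] conjI ballI)
      show "openin (prod_topology ?T ?T) (?U \<times> ?V)"
        using openin_length_ball[OF N' gh(2)] openin_length_ball[OF N gh(3)] openin_prod_Times_iff by blast
      show "p \<in> ?U \<times> ?V" using gh e N by (simp add: len_one)
      fix q assume "q \<in> ?U \<times> ?V"
      then obtain g' h' where q: "q = (g', h')" "g' \<in> carrier G" "h' \<in> carrier G"
        "N (inv h \<otimes> (inv g \<otimes> g') \<otimes> h) < e/2" "N (inv h \<otimes> h') < e/2" by auto
      have "inv (g \<otimes> h) \<otimes> (g' \<otimes> h') = inv h \<otimes> (inv g \<otimes> g') \<otimes> h'"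
        using gh q by (simp add: inv_mult_group m_assoc)
      also have "\<dots> = (inv h \<otimes> (inv g \<otimes> g') \<otimes> h) \<otimes> (inv h \<otimes> h')"
        using gh q by (simp add: m_assoc) (metis inv_closed inv_solve_left m_assoc m_closed)
      finally have "N (inv (g \<otimes> h) \<otimes> (g' \<otimes> h')) < e"
        using len_mult[OF N, of "inv h \<otimes> (inv g \<otimes> g') \<otimes> h" "inv h \<otimes> h'"] gh q by simp
      then show "N (inv (case p of (x, y) \<Rightarrow> x \<otimes> y) \<otimes> (case q of (x, y) \<Rightarrow> x \<otimes> y)) < e"
        using gh q by simp
    qed
  qed auto
  moreover have "continuous_map ?T ?T (\<lambda>x. inv x)"
    unfolding continuous_map_length_topology
  proof (intro conjI ballI allI impI)
    fix g N and e :: real assume g: "g \<in> topspace ?T" and N: "N \<in> \<N>" and e: "e > 0"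
    then have gc: "g \<in> carrier G" "inv g \<in> carrier G" by auto
    let ?N' = "\<lambda>x. N (inv (inv g) \<otimes> x \<otimes> inv g)"
    have N': "?N' \<in> \<N>" using conj[OF N gc(2)] .
    let ?U = "{h \<in> carrier G. ?N' (inv g \<otimes> h) < e}"
    show "\<exists>V. openin ?T V \<and> g \<in> V \<and> (\<forall>y\<in>V. N (inv (inv g) \<otimes> inv y) < e)"
    proof (intro exI[of _ ?U] conjI ballI)
      show "openin ?T ?U" using openin_length_ball[OF N' gc(1)] .
      show "g \<in> ?U" using gc e N by (simp add: len_one)
      fix h assume h: "h \<in> ?U"
      have "inv (inv g) \<otimes> (inv g \<otimes> h) \<otimes> inv g = inv (inv (inv g) \<otimes> inv h)"
        using gc h by (simp add: inv_mult_group m_assoc[symmetric])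
      then show "N (inv (inv g) \<otimes> inv h) < e"
        using h gc len_inv[OF N, of "inv (inv g) \<otimes> inv h"] by simp
    qed
  qed auto
  ultimately show ?thesis by (simp add: topological_group_def is_group)
qed

lemma Hausdorff_length_topology:
  assumes sep: "\<And>g. g \<in> carrier G \<Longrightarrow> g \<noteq> \<one> \<Longrightarrow> \<exists>N\<in>\<N>. N g > 0"
  shows "Hausdorff_space (length_topology G \<N>)"
  unfolding Hausdorff_space_def
proof (intro allI impI)
  fix g h assume "g \<in> topspace (length_topology G \<N>) \<and> h \<in> topspace (length_topology G \<N>) \<and> g \<noteq> h"
  then have gh: "g \<in> carrier G" "h \<in> carrier G" "g \<noteq> h" by auto
  then have "inv g \<otimes> h \<noteq> \<one>" by (metis inv_closed inv_equality inv_inv)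
  then obtain N where N: "N \<in> \<N>" "N (inv g \<otimes> h) > 0"
    using sep[of "inv g \<otimes> h"] gh by auto
  let ?e = "N (inv g \<otimes> h) / 2"
  let ?U = "{k \<in> carrier G. N (inv g \<otimes> k) < ?e}" and ?V = "{k \<in> carrier G. N (inv h \<otimes> k) < ?e}"
  have "disjnt ?U ?V"
    unfolding disjnt_iff
  proof (intro allI notI)
    fix k assume k: "k \<in> ?U \<and> k \<in> ?V"
    then have "N (inv k \<otimes> h) = N (inv h \<otimes> k)"
      using gh len_inv[OF N(1), of "inv h \<otimes> k"] by (simp add: inv_mult_group)
    then show False using k len_triangle[OF N(1) gh(1), of k h] gh by auto
  qed
  moreover have "openin (length_topology G \<N>) ?U" "openin (length_topology G \<N>) ?V"
    using openin_length_ball[OF N(1) gh(1)] openin_length_ball[OF N(1) gh(2)] by blast+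
  moreover have "g \<in> ?U" "h \<in> ?V" using gh N by (auto simp: len_one)
  ultimately show "\<exists>U V. openin (length_topology G \<N>) U \<and> openin (length_topology G \<N>) V \<and>
      g \<in> U \<and> h \<in> V \<and> disjnt U V" by blast
qed

text \<open>The open balls of integer radius about the identity increase to the whole group. All
  later information on compact sets is drawn from this bound, by choosing suitable length
  functions.\<close>

lemma compactin_length_bounded:
  assumes "N \<in> \<N>" "compactin (length_topology G \<N>) K"
  shows "\<exists>B. \<forall>g\<in>K. N g \<le> B"
proof -
  let ?V = "\<lambda>n::nat. {h \<in> carrier G. N (inv \<one> \<otimes> h) < real n}"
  have sub: "K \<subseteq> carrier G" using compactin_subset_topspace[OF assms(2)] by simp
  have "openin (length_topology G \<N>) U" if "U \<in> range ?V" for U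
    using that openin_length_ball[OF assms(1) one_closed] by blast
  moreover have "K \<subseteq> \<Union>(range ?V)"
    using sub reals_Archimedean2 by fastforce
  ultimately obtain \<F> where F: "finite \<F>" "\<F> \<subseteq> range ?V" "K \<subseteq> \<Union>\<F>"
    using assms(2) unfolding compactin_def by meson
  then obtain J where J: "finite J" "\<F> = ?V ` J" 
    using finite_subset_image[OF F(1,2)] by blast
  have "N g \<le> real (Max J)" if g: "g \<in> K" for g
  proof -
    obtain n where "n \<in> J" "N g < real n" using g F(3) J(2) sub by auto
    moreover from this have "n \<le> Max J" using J(1) by simp
    ultimately show ?thesis by linarith
  qed
  then show ?thesis by blast
qed

end

section \<open>Letters as generators of the group of reduced words\<close>

definition letter :: "'a \<Rightarrow> ('a \<times> bool) list" where
  "letter x = [(x, True)]"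

lemma letter_closed [simp]: "x \<in> S \<Longrightarrow> letter x \<in> carrier (free_group S)"
  by (simp add: letter_def free_group_simps)

lemma length_letter [simp]: "length (letter x) = 1"
  by (simp add: letter_def)

lemma free_lift_letter: "group H \<Longrightarrow> f x \<in> carrier H \<Longrightarrow> free_lift H f (letter x) = f x"
  by (simp add: letter_def group.is_monoid monoid.r_one)

lemma free_group_Cons:
  assumes "a # w \<in> carrier (free_group S)"
  shows "a # w = [a] \<otimes>\<^bsub>free_group S\<^esub> w" "[a] \<in> carrier (free_group S)" "w \<in> carrier (free_group S)"
  using assms reduced_ConsD[of a w] by (auto simp: free_group_simps push_Cons_reduced)

lemma single_eq_letter:
  assumes "[a] \<in> carrier (free_group S)"
  shows "[a] = letter (fst a) \<or> [a] = inv\<^bsub>free_group S\<^esub> letter (fst a)"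
  using assms inv_free_group[of "letter (fst a)" S] by (cases a) (auto simp: letter_def flip_def free_group_simps)

section \<open>Weighted word length\<close>

definition word_weight :: "('a \<Rightarrow> real) \<Rightarrow> ('a \<times> bool) list \<Rightarrow> real" where
  "word_weight \<omega> w = (\<Sum>a\<leftarrow>w. \<omega> (fst a))"

lemma word_weight_simps [simp]:
  "word_weight \<omega> [] = 0" "word_weight \<omega> (a # w) = \<omega> (fst a) + word_weight \<omega> w"
  by (simp_all add: word_weight_def)

lemma word_weight_nonneg: "(\<And>k. 0 \<le> \<omega> k) \<Longrightarrow> 0 \<le> word_weight \<omega> w"
  by (induction w) auto

lemma word_weight_append: "word_weight \<omega> (u @ v) = word_weight \<omega> u + word_weight \<omega> v"
  by (simp add: word_weight_def)

lemma word_weight_word_inv: "word_weight \<omega> (word_inv w) = word_weight \<omega> w"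
  by (induction w) (auto simp: word_weight_append)

lemma word_weight_push:
  assumes "\<And>k. 0 \<le> \<omega> k"
  shows "word_weight \<omega> (push a w) \<le> \<omega> (fst a) + word_weight \<omega> w"
  using assms by (cases w) (auto simp: add_nonneg_nonneg)

lemma length_function_word_weight:
  assumes "\<And>k. 0 \<le> \<omega> k"
  shows "length_function (free_group S) (word_weight \<omega>)"
proof -
  have "word_weight \<omega> (foldr push u v) \<le> word_weight \<omega> u + word_weight \<omega> v" for u v
  proof (induction u)
    case (Cons a u)
    then show ?case using word_weight_push[of \<omega> a "foldr push u v"] assms by simp
  qed simp
  then show ?thesis
    using assms by (simp add: length_function_def word_weight_nonneg word_weight_word_inv inv_free_group
        free_group_simps(2,3))
qed

lemma word_weight_ge:
  assumes "\<And>k. 0 \<le> \<omega> k" "k \<in> fst ` set w"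
  shows "\<omega> k \<le> word_weight \<omega> w"
  using assms(2)
proof (induction w)
  case (Cons a w)
  have "0 \<le> \<omega> (fst a)" "0 \<le> word_weight \<omega> w"
    using assms(1) by (auto intro: word_weight_nonneg)
  then show ?case using Cons by fastforce
qed simp

lemma word_weight_ge_length: "(\<And>k. 1 \<le> \<omega> k) \<Longrightarrow> real (length w) \<le> word_weight \<omega> w"
  by (induction w) (auto simp: add_mono)

section \<open>Random rounding\<close>

text \<open>For s in [0,1] a letter is produced only within distance 1/3 of an integer. The zones of
  different integers are at least 1/3 apart, so reals closer than that never receive two different
  letters.\<close>

definition rounding :: "real \<Rightarrow> real \<Rightarrow> (int \<times> bool) list" where
  "rounding s r = (if 3 * \<bar>r - of_int (round r)\<bar> < 1 - s then letter (round r) else [])"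

definition rounded_word :: "('a \<Rightarrow> real) \<Rightarrow> real \<Rightarrow> ('a \<times> bool) list \<Rightarrow> (int \<times> bool) list" where
  "rounded_word q s = free_lift (free_group UNIV) (\<lambda>x. rounding s (q x))"

text \<open>Label 0 is reserved for the one letter that is to be detected: the functions q used with
  a large weight vanish there and are at least 1 away from it.\<close>

definition label_weight :: "real \<Rightarrow> int \<Rightarrow> real" where
  "label_weight W k = (if k = 0 then W else 1)"

text \<open>For a fixed threshold s the weight jumps when the values of q vary; the mean over s
  removes the jumps.\<close>

definition rounded_length :: "real \<Rightarrow> ('a \<Rightarrow> real) \<Rightarrow> ('a \<times> bool) list \<Rightarrow> real" where
  "rounded_length W q w =
     (LINT s|restrict_space lborel {0..1}. word_weight (label_weight W) (rounded_word q s w))"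

lemma rounding_closed [simp]: "rounding s r \<in> carrier (free_group UNIV)"
  by (simp add: rounding_def letter_def free_group_simps)

text \<open>The letter at r is present exactly while \<open>s < t r\<close>. If both letters are
  present they agree, since r and r' are close; so the roundings differ only when s lies between the
  two thresholds.\<close>

lemma rounding_neqD:
  assumes "\<bar>r - r'\<bar> < 1/3" "0 \<le> s" "rounding s r \<noteq> rounding s r'"
  defines "t \<equiv> \<lambda>r::real. 1 - 3 * \<bar>r - of_int (round r)\<bar>"
  shows "s \<in> {min (t r) (t r')..max (t r) (t r')}"
proof (rule ccontr)
  assume s: "\<not> ?thesis"
  have "s < t r \<and> s < t r'"
    using s assms(3) by (auto simp: rounding_def t_def min_def max_def split: if_splits)
  then have "\<bar>r - of_int (round r)\<bar> < 1/3" "\<bar>r' - of_int (round r')\<bar> < 1/3"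
    using assms(2) by (auto simp: t_def)
  then have "\<bar>real_of_int (round r) - of_int (round r')\<bar> < 1" using assms(1) by linarith
  then have "round r = round r'" by linarith
  with \<open>s < t r \<and> s < t r'\<close> have "rounding s r = rounding s r'" by (simp add: rounding_def t_def)
  with assms(3) show False by simp
qed

text \<open>The quantity compared is the distance to the set of integers: \<open>round\<close> is a
  nearest integer, and the one for r' also competes for r.\<close>

lemma dist_round_Lipschitz:
  "\<bar>\<bar>r - of_int (round r)\<bar> - \<bar>r' - of_int (round r')\<bar>\<bar> \<le> \<bar>r - r'\<bar>" for r r' :: real
  using round_diff_minimal[of r "round r'"] round_diff_minimal[of r' "round r"] by linarith

lemma rounded_word_hom: "rounded_word q s \<in> hom (free_group S) (free_group UNIV)"
  unfolding rounded_word_def by (rule group.free_lift_hom[OF group_free_group]) auto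

lemma rounded_word_group_hom: "group_hom (free_group S) (free_group UNIV) (rounded_word q s)"
  using rounded_word_hom[of q s S] by (simp add: group_hom_def group_hom_axioms_def group_free_group)

lemma rounded_word_letter: "rounded_word q s (letter x) = rounding s (q x)"
  unfolding rounded_word_def using rounding_closed by (rule free_lift_letter[OF group_free_group])

lemma measure_unit: "measure (restrict_space lborel {0..1::real}) {0..1} = 1"
  by (simp add: measure_restrict_space)

lemma finite_measure_unit: "finite_measure (restrict_space lborel {0..1::real})"
  by (rule finite_measureI) (simp add: space_restrict_space emeasure_restrict_space)

text \<open>As a function of s the word is a step function: each letter is switched off at one
  threshold. Hence it is measurable even for the discrete structure on words.\<close>

lemma measurable_rounded_word [measurable]:
  "(\<lambda>s. rounded_word q s w) \<in> measurable (restrict_space lborel {0..1}) (count_space UNIV)"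
proof (induction w)
  case Nil
  then show ?case by (simp add: rounded_word_def)
next
  case (Cons a w)
  let ?D = "free_group (UNIV :: int set)"
  let ?c = "if snd a then letter (round (q (fst a))) else inv\<^bsub>?D\<^esub> letter (round (q (fst a)))"
  have one: "\<one>\<^bsub>?D\<^esub> = []" by (simp add: free_group_simps)
  have inv1: "inv\<^bsub>?D\<^esub> [] = []" using monoid.inv_one[OF group.is_monoid[OF group_free_group[of UNIV]]] one by metis
  have "[] \<otimes>\<^bsub>?D\<^esub> v = v" for v by (simp add: free_group_simps)
  then have eq: "rounded_word q s (a # w) = (if 3 * \<bar>q (fst a) - of_int (round (q (fst a)))\<bar> < 1 - s
      then ?c \<otimes>\<^bsub>?D\<^esub> rounded_word q s w else rounded_word q s w)" for s
    by (simp add: rounded_word_def rounding_def inv1)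
  have 1: "(\<lambda>s. ?c \<otimes>\<^bsub>?D\<^esub> rounded_word q s w)
      \<in> measurable (restrict_space lborel {0..1}) (count_space UNIV)"
    using Cons by (rule measurable_compose) simp
  show ?case
    unfolding eq
  proof (rule measurable_If[OF 1 Cons])
    let ?\<tau> = "3 * \<bar>q (fst a) - of_int (round (q (fst a)))\<bar>"
    have "{s \<in> space (restrict_space lborel {0..1}). ?\<tau> < 1 - s} = {0..1} \<inter> {..<1 - ?\<tau>}"
      by (auto simp: space_restrict_space)
    then show "{s \<in> space (restrict_space lborel {0..1}). ?\<tau> < 1 - s} \<in> sets (restrict_space lborel {0..1})"
      by (simp add: sets_restrict_space_iff)
  qed
qed

context
  fixes W :: real and q :: "'a \<Rightarrow> real"
  assumes W: "1 \<le> W"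
begin

lemma label_weight_ge_1: "1 \<le> label_weight W k"
  using W by (simp add: label_weight_def)

lemma label_weight_nonneg: "0 \<le> label_weight W k"
  using label_weight_ge_1[of k] by linarith

lemma label_weight_le: "label_weight W k \<le> W"
  using W by (simp add: label_weight_def)

lemma length_function_label_weight: "length_function (free_group S) (word_weight (label_weight W))"
  by (intro length_function_word_weight label_weight_nonneg)

lemma weight_mult_le:
  assumes "u \<in> carrier (free_group UNIV)" "v \<in> carrier (free_group UNIV)"
  shows "word_weight (label_weight W) (u \<otimes>\<^bsub>free_group UNIV\<^esub> v)
     \<le> word_weight (label_weight W) u + word_weight (label_weight W) v"
  using length_function_label_weight[of UNIV] assms unfolding length_function_def by blast

lemma weight_inv:
  assumes "u \<in> carrier (free_group UNIV)"
  shows "word_weight (label_weight W) (inv\<^bsub>free_group UNIV\<^esub> u) = word_weight (label_weight W) u"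
  using length_function_label_weight[of UNIV] assms unfolding length_function_def by blast

lemma weight_rounded_word_le: "word_weight (label_weight W) (rounded_word q s w) \<le> W * length w"
proof (induction w)
  case Nil
  then show ?case by (simp add: rounded_word_def free_group_simps)
next
  case (Cons a w)
  let ?D = "free_group (UNIV :: int set)"
  let ?c = "if snd a then rounding s (q (fst a)) else inv\<^bsub>?D\<^esub> rounding s (q (fst a))"
  have cl: "rounded_word q s w \<in> carrier ?D"
    unfolding rounded_word_def by (rule group.free_lift_closed[OF group_free_group]) auto
  have ccl: "?c \<in> carrier ?D" using group.inv_closed[OF group_free_group rounding_closed] rounding_closed by metis
  have "word_weight (label_weight W) ?c = word_weight (label_weight W) (rounding s (q (fst a)))"
    by (simp add: weight_inv)
  also have "\<dots> \<le> W"
    using W label_weight_le by (auto simp: rounding_def letter_def)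
  finally have "word_weight (label_weight W) ?c \<le> W" .
  moreover have "rounded_word q s (a # w) = ?c \<otimes>\<^bsub>?D\<^esub> rounded_word q s w"
    by (simp add: rounded_word_def)
  ultimately show ?case
    using weight_mult_le[OF ccl cl] Cons by (simp add: algebra_simps)
qed

lemma integrable_weight_rounded_word:
  "integrable (restrict_space lborel {0..1}) (\<lambda>s. word_weight (label_weight W) (rounded_word q s w))"
proof (rule finite_measure.integrable_const_bound)
  show "finite_measure (restrict_space lborel {0..1::real})"
    by (rule finite_measure_unit)
  show "AE s in restrict_space lborel {0..1}.
      norm (word_weight (label_weight W) (rounded_word q s w)) \<le> W * length w"
    using weight_rounded_word_le word_weight_nonneg[of "label_weight W", OF label_weight_nonneg] by auto
  show "(\<lambda>s. word_weight (label_weight W) (rounded_word q s w))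
      \<in> borel_measurable (restrict_space lborel {0..1})"
    by (rule measurable_compose[OF measurable_rounded_word]) simp
qed

lemma rounded_length_le:
  assumes "\<And>s. word_weight (label_weight W) (rounded_word q s w) \<le> B"
  shows "rounded_length W q w \<le> B"
proof -
  have "rounded_length W q w \<le> (LINT s|restrict_space lborel {0..1::real}. B)"
    unfolding rounded_length_def
    by (intro integral_mono integrable_weight_rounded_word assms finite_measure.integrable_const
        finite_measure_unit)
  then show ?thesis by (simp add: measure_unit)
qed

lemma length_function_rounded_length: "length_function (free_group S) (rounded_length W q)"
  unfolding length_function_def
proof (intro conjI ballI)
  let ?wt = "word_weight (label_weight W)"
  show "rounded_length W q \<one>\<^bsub>free_group S\<^esub> = 0"
    by (simp add: rounded_length_def rounded_word_def free_group_simps)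
  fix u assume u: "u \<in> carrier (free_group S)"
  show "0 \<le> rounded_length W q u"
    unfolding rounded_length_def
    by (intro integral_nonneg_AE) (auto simp: word_weight_nonneg label_weight_nonneg)
  have "?wt (rounded_word q s (inv\<^bsub>free_group S\<^esub> u)) = ?wt (rounded_word q s u)" for s
  proof -
    interpret group_hom "free_group S" "free_group UNIV" "rounded_word q s"
      by (rule rounded_word_group_hom)
    show ?thesis using hom_inv[OF u] weight_inv[OF hom_closed[OF u]] by simp
  qed
  then show "rounded_length W q (inv\<^bsub>free_group S\<^esub> u) = rounded_length W q u"
    by (simp add: rounded_length_def)
  fix v assume v: "v \<in> carrier (free_group S)"
  have *: "?wt (rounded_word q s (u \<otimes>\<^bsub>free_group S\<^esub> v)) \<le> ?wt (rounded_word q s u) + ?wt (rounded_word q s v)" for s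
  proof -
    interpret group_hom "free_group S" "free_group UNIV" "rounded_word q s"
      by (rule rounded_word_group_hom)
    show ?thesis using hom_mult[OF u v] weight_mult_le[OF hom_closed[OF u] hom_closed[OF v]] by simp
  qed
  have "rounded_length W q (u \<otimes>\<^bsub>free_group S\<^esub> v)
      \<le> (LINT s|restrict_space lborel {0..1}. ?wt (rounded_word q s u) + ?wt (rounded_word q s v))"
    unfolding rounded_length_def
    by (intro integral_mono Bochner_Integration.integrable_add integrable_weight_rounded_word *)
  then show "rounded_length W q (u \<otimes>\<^bsub>free_group S\<^esub> v) \<le> rounded_length W q u + rounded_length W q v"
    by (simp add: rounded_length_def integrable_weight_rounded_word)
qed

lemma rounded_length_letter_le_1:
  assumes "W = 1 \<or> 1 \<le> q x"
  shows "rounded_length W q (letter x) \<le> 1"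
proof (rule rounded_length_le)
  have "round (q x) \<noteq> 0" if "1 \<le> q x" using round_mono[OF that] by simp
  then show "word_weight (label_weight W) (rounded_word q s (letter x)) \<le> 1" for s
    using assms unfolding rounded_word_letter
    by (auto simp: rounding_def letter_def label_weight_def)
qed

text \<open>If x and y are rounded alike, the conjugate has trivial image. Otherwise s lies in the
  interval \<open>J\<close> between their thresholds, whose length is at most three times the
  distance of q x and q y, and on \<open>J\<close> the weight is at most W times the total number of
  letters.\<close>

lemma rounded_length_conj_le:
  assumes g: "g \<in> carrier (free_group S)" and xy: "x \<in> S" "y \<in> S" "\<bar>q x - q y\<bar> < 1/3"
  shows "rounded_length W q (inv\<^bsub>free_group S\<^esub> g \<otimes>\<^bsub>free_group S\<^esub>
      (inv\<^bsub>free_group S\<^esub> letter x \<otimes>\<^bsub>free_group S\<^esub> letter y) \<otimes>\<^bsub>free_group S\<^esub> g)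
     \<le> W * (2 * length g + 2) * (3 * \<bar>q x - q y\<bar>)" (is "rounded_length W q ?z \<le> ?C * _")
proof -
  let ?wt = "word_weight (label_weight W)" and ?F = "free_group S"
  define t where "t r = 1 - 3 * \<bar>r - of_int (round r)\<bar>" for r :: real
  define J where "J = {min (t (q x)) (t (q y))..max (t (q x)) (t (q y))}"
  interpret F: group ?F by (rule group_free_group)
  have C: "0 \<le> ?C" using W by simp
  have z: "?z \<in> carrier ?F" using g xy by (intro F.m_closed F.inv_closed letter_closed)
  have bd: "?wt (rounded_word q s ?z) \<le> ?C * indicator J s" if s: "s \<in> {0..1}" for s
  proof -
    interpret h: group_hom ?F "free_group UNIV" "rounded_word q s"
      by (rule rounded_word_group_hom)
    let ?g = "rounded_word q s g" and ?x = "rounding s (q x)" and ?y = "rounding s (q y)"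
    have gc: "?g \<in> carrier (free_group UNIV)" using h.hom_closed[OF g] .
    have e: "rounded_word q s ?z = inv\<^bsub>free_group UNIV\<^esub> ?g \<otimes>\<^bsub>free_group UNIV\<^esub>
      (inv\<^bsub>free_group UNIV\<^esub> ?x \<otimes>\<^bsub>free_group UNIV\<^esub> ?y) \<otimes>\<^bsub>free_group UNIV\<^esub> ?g"
      using g xy by (simp add: h.hom_mult h.hom_inv rounded_word_letter F.m_closed F.inv_closed)
    show ?thesis
    proof (cases "?x = ?y")
      case True
      then have "rounded_word q s ?z = \<one>\<^bsub>free_group UNIV\<^esub>"
        unfolding e using gc rounding_closed[of s "q y"] by (simp)
      then show ?thesis using C by (simp add: free_group_simps indicator_def)
    next
      case False
      then have "s \<in> J" unfolding J_def t_def using rounding_neqD[OF xy(3) _ False] s by simp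
      moreover have "?wt (rounded_word q s ?z) \<le> ?wt ?g + (?wt ?x + ?wt ?y) + ?wt ?g"
        unfolding e
        by (intro order_trans[OF weight_mult_le] add_mono h.H.m_closed h.H.inv_closed gc rounding_closed)
          (simp_all add: weight_inv gc)
      moreover have "?wt ?x \<le> W" "?wt ?y \<le> W"
        using weight_rounded_word_le[of s "letter x"] weight_rounded_word_le[of s "letter y"]
        by (simp_all add: rounded_word_letter)
      ultimately show ?thesis
        using weight_rounded_word_le[of s g] by (simp add: algebra_simps)
    qed
  qed
  have "rounded_length W q ?z \<le> (LINT s|restrict_space lborel {0..1}. ?C * indicator J s)"
    unfolding rounded_length_def
  proof (intro integral_mono integrable_weight_rounded_word)
    show "integrable (restrict_space lborel {0..1}) (\<lambda>s. ?C * indicat_real J s)"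
      by (intro integrable_mult_right finite_measure.integrable_const_bound[where B = 1]
          finite_measure_unit measurable_restrict_space1) (auto simp: J_def)
  qed (use bd in \<open>auto simp: space_restrict_space\<close>)
  also have "\<dots> = ?C * measure (restrict_space lborel {0..1}) (J \<inter> {0..1})"
    by (simp only: integral_mult_right_zero Bochner_Integration.integral_indicator space_restrict_space) simp
  also have "\<dots> = ?C * measure lborel (J \<inter> {0..1})"
    by (subst measure_restrict_space) auto
  also have "\<dots> \<le> ?C * measure lborel J"
    by (intro mult_left_mono C measure_mono_fmeasurable)
      (auto simp: J_def emeasure_lborel_Icc_eq intro!: fmeasurableI)
  also have "\<dots> = ?C * \<bar>t (q x) - t (q y)\<bar>"
    by (auto simp: J_def min_def max_def)
  also have "\<dots> \<le> ?C * (3 * \<bar>q x - q y\<bar>)"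
  proof (intro mult_left_mono C)
    have "\<bar>1 - 3 * a - (1 - 3 * b)\<bar> \<le> 3 * c" if "\<bar>a - b\<bar> \<le> c" for a b c :: real
      using that by linarith
    from this[OF dist_round_Lipschitz] show "\<bar>t (q x) - t (q y)\<bar> \<le> 3 * \<bar>q x - q y\<bar>"
      unfolding t_def .
  qed
  finally show ?thesis .
qed

text \<open>The rounding fixes the integers, so on words over letters with distinct integral \<open>q\<close>-values
  it is a mere renaming and nothing cancels.\<close>

lemma rounded_length_integral:
  assumes w: "w \<in> carrier (free_group S)" and inj: "inj_on q (fst ` set w)"
    and int: "\<And>x. x \<in> fst ` set w \<Longrightarrow> q x \<in> \<int>"
  shows "rounded_length W q w = word_weight (\<lambda>x. label_weight W (round (q x))) w"
proof -
  \<comment> \<open>At s = 1 the strict inequality in \<open>rounding\<close> fails even at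
    integers, and all letters are lost. That single threshold is a null set for the
    integral.\<close>
  have eq: "rounded_word q s w = map (\<lambda>a. (round (q (fst a)), snd a)) w" if "s < 1" for s
  proof -
    have "inj_on (round \<circ> q) (fst ` set w)"
    proof (rule inj_onI)
      fix x y assume xy: "x \<in> fst ` set w" "y \<in> fst ` set w" "(round \<circ> q) x = (round \<circ> q) y"
      obtain k l where "q x = of_int k" "q y = of_int l" using int xy by (metis Ints_cases)
      then have "q x = q y" using xy(3) by simp
      then show "x = y" using inj xy by (auto dest: inj_onD)
    qed
    moreover have "is_reduced w" using w by (simp add: free_group_simps)
    ultimately show ?thesis
      using int
    proof (induction w)
      case Nil
      then show ?case by (simp add: rounded_word_def free_group_simps)
    next
      case (Cons a w)
      let ?m = "map (\<lambda>a. (round (q (fst a)), snd a))"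
      have IH: "rounded_word q s w = ?m w"
        using Cons.prems reduced_ConsD[of a w] by (intro Cons.IH) (auto simp: inj_on_def)
      obtain k where k: "q (fst a) = of_int k" using Cons.prems(3)[of "fst a"] by (auto elim: Ints_cases)
      have "rounding s (q (fst a)) = letter k" using k that by (simp add: rounding_def)
      then have "(if snd a then rounding s (q (fst a)) else inv\<^bsub>free_group UNIV\<^esub> rounding s (q (fst a))) = ?m [a]"
        using k inv_free_group[of "letter k" UNIV] letter_closed[of k UNIV]
        by (cases a) (auto simp: letter_def flip_def)
      then have e: "rounded_word q s (a # w) = push ((round (q (fst a)), snd a)) (?m w)"
        using IH by (simp add: rounded_word_def free_group_simps)
      show ?case
      proof (cases w)
        case (Cons b w')
        have "b \<noteq> flip a" using Cons.prems(2) Cons by simp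
        moreover have "(round \<circ> q) (fst b) = (round \<circ> q) (fst a) \<Longrightarrow> fst b = fst a"
          using inj_onD[OF Cons.prems(1), of "fst b" "fst a"] Cons by simp
        ultimately have "(round (q (fst b)), snd b) \<noteq> flip ((round (q (fst a)), snd a))"
          by (cases a; cases b) (auto simp: flip_def)
        then show ?thesis using e Cons by simp
      qed (use e in simp)
    qed
  qed
  let ?c = "word_weight (label_weight W) (map (\<lambda>a. (round (q (fst a)), snd a)) w)"
  have "rounded_length W q w = (LINT s|restrict_space lborel {0..1::real}. ?c)"
    unfolding rounded_length_def
  proof (rule integral_cong_AE)
    have "AE s in lborel. s \<noteq> (1::real)" by (rule AE_lborel_singleton)
    then show "AE s in restrict_space lborel {0..1}. word_weight (label_weight W) (rounded_word q s w) = ?c"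
      by (subst AE_restrict_space_iff) (auto simp: eq elim: eventually_mono)
  qed (use borel_measurable_integrable[OF integrable_weight_rounded_word] in auto)
  also have "\<dots> = ?c" by (simp add: measure_unit)
  also have "?c = word_weight (\<lambda>x. label_weight W (round (q x))) w"
    by (simp add: word_weight_def comp_def)
  finally show ?thesis .
qed

end

section \<open>Continuous length functions\<close>

text \<open>The conjugates by all g are included so that the family becomes closed under
  conjugation; the case of trivial g gives the continuity of \<open>letter\<close>.\<close>

definition continuous_length :: "'a topology \<Rightarrow> (('a \<times> bool) list \<Rightarrow> real) \<Rightarrow> bool" where
  "continuous_length X N \<longleftrightarrow> length_function (free_group (topspace X)) N \<and>
     (\<forall>g\<in>carrier (free_group (topspace X)). \<forall>x\<in>topspace X.
        ((\<lambda>y. N (inv\<^bsub>free_group (topspace X)\<^esub> g \<otimes>\<^bsub>free_group (topspace X)\<^esub>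
           (inv\<^bsub>free_group (topspace X)\<^esub> letter x \<otimes>\<^bsub>free_group (topspace X)\<^esub> letter y)
             \<otimes>\<^bsub>free_group (topspace X)\<^esub> g)) \<longlongrightarrow> 0) (nhdsin X x))"

lemma continuous_map_imp_tendsto_nhdsin:
  assumes "continuous_map X euclideanreal q" "x \<in> topspace X"
  shows "(q \<longlongrightarrow> q x) (nhdsin X x)"
proof (rule topological_tendstoI)
  fix U assume "open U" "q x \<in> U"
  then have "openin X {y \<in> topspace X. q y \<in> U}"
    using assms(1) openin_continuous_map_preimage by force
  then show "\<forall>\<^sub>F y in nhdsin X x. q y \<in> U"
    using assms(2) \<open>q x \<in> U\<close> unfolding eventually_nhdsin by blast
qed

lemma eventually_nhdsin_topspace: "\<forall>\<^sub>F y in nhdsin X x. y \<in> topspace X"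
  unfolding eventually_nhdsin by blast

lemma length_functionD:
  assumes "length_function G N"
  shows "N \<one>\<^bsub>G\<^esub> = 0" "x \<in> carrier G \<Longrightarrow> 0 \<le> N x" "x \<in> carrier G \<Longrightarrow> N (inv\<^bsub>G\<^esub> x) = N x"
    "x \<in> carrier G \<Longrightarrow> y \<in> carrier G \<Longrightarrow> N (x \<otimes>\<^bsub>G\<^esub> y) \<le> N x + N y"
  using assms by (auto simp: length_function_def)

lemma (in group) length_function_conj_le:
  assumes "length_function G N" "g \<in> carrier G" "z \<in> carrier G"
  shows "N (inv g \<otimes> z \<otimes> g) \<le> 2 * N g + N z"
  using length_functionD(4)[OF assms(1), of "inv g \<otimes> z" g] length_functionD(4)[OF assms(1), of "inv g" z]
    length_functionD(3)[OF assms(1,2)] assms(2,3) by simp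

lemma (in group) length_function_conj:
  assumes "length_function G N" "g \<in> carrier G"
  shows "length_function G (\<lambda>x. N (inv g \<otimes> x \<otimes> g))"
  unfolding length_function_def
proof (intro conjI ballI)
  fix x assume x: "x \<in> carrier G"
  have "inv g \<otimes> inv x \<otimes> g = inv (inv g \<otimes> x \<otimes> g)"
    using x assms(2) by (simp add: inv_mult_group m_assoc)
  then show "N (inv g \<otimes> inv x \<otimes> g) = N (inv g \<otimes> x \<otimes> g)"
    using x assms by (simp add: length_functionD(3))
  fix y assume y: "y \<in> carrier G"
  have "g \<otimes> (inv g \<otimes> (y \<otimes> g)) = y \<otimes> g"
    using y assms(2) by (simp add: m_assoc[symmetric])
  then have "inv g \<otimes> (x \<otimes> y) \<otimes> g = (inv g \<otimes> x \<otimes> g) \<otimes> (inv g \<otimes> y \<otimes> g)"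
    using x y assms(2) by (simp add: m_assoc)
  then show "N (inv g \<otimes> (x \<otimes> y) \<otimes> g) \<le> N (inv g \<otimes> x \<otimes> g) + N (inv g \<otimes> y \<otimes> g)"
    using x y assms by (simp add: length_functionD(4))
qed (use assms in \<open>auto intro: length_functionD\<close>)

lemma length_family_continuous_length:
  "length_family (free_group (topspace X)) {N. continuous_length X N}"
proof -
  let ?F = "free_group (topspace X)"
  interpret F: group ?F by (rule group_free_group)
  show ?thesis
  proof
    show "length_function ?F N" if "N \<in> {N. continuous_length X N}" for N
      using that by (simp add: continuous_length_def)
    have "continuous_length X (\<lambda>_. 0)"
      by (simp add: continuous_length_def length_function_def)
    then show "{N. continuous_length X N} \<noteq> {}" by blast
  next
    fix N N' assume N: "N \<in> {N. continuous_length X N}" "N' \<in> {N. continuous_length X N}"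
    then have "length_function ?F N" "length_function ?F N'" by (auto simp: continuous_length_def)
    then have "length_function ?F (\<lambda>x. N x + N' x)"
      by (auto simp: length_function_def) (smt (verit))
    then show "(\<lambda>x. N x + N' x) \<in> {N. continuous_length X N}"
      using N by (auto simp: continuous_length_def intro: tendsto_add_zero)
  next
    fix N h assume N: "N \<in> {N. continuous_length X N}" and h: "h \<in> carrier ?F"
    then have N': "length_function ?F N" by (simp add: continuous_length_def)
    have "((\<lambda>y. N (inv\<^bsub>?F\<^esub> h \<otimes>\<^bsub>?F\<^esub> (inv\<^bsub>?F\<^esub> g \<otimes>\<^bsub>?F\<^esub>
        (inv\<^bsub>?F\<^esub> letter x \<otimes>\<^bsub>?F\<^esub> letter y) \<otimes>\<^bsub>?F\<^esub> g) \<otimes>\<^bsub>?F\<^esub> h)) \<longlongrightarrow> 0) (nhdsin X x)"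
      if g: "g \<in> carrier ?F" and x: "x \<in> topspace X" for g x
    proof (rule Lim_transform_eventually)
      let ?g = "g \<otimes>\<^bsub>?F\<^esub> h"
      show "((\<lambda>y. N (inv\<^bsub>?F\<^esub> ?g \<otimes>\<^bsub>?F\<^esub> (inv\<^bsub>?F\<^esub> letter x \<otimes>\<^bsub>?F\<^esub> letter y) \<otimes>\<^bsub>?F\<^esub> ?g)) \<longlongrightarrow> 0) (nhdsin X x)"
        using N x F.m_closed[OF g h] by (simp add: continuous_length_def)
      show "\<forall>\<^sub>F y in nhdsin X x. N (inv\<^bsub>?F\<^esub> ?g \<otimes>\<^bsub>?F\<^esub> (inv\<^bsub>?F\<^esub> letter x \<otimes>\<^bsub>?F\<^esub> letter y) \<otimes>\<^bsub>?F\<^esub> ?g) =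
          N (inv\<^bsub>?F\<^esub> h \<otimes>\<^bsub>?F\<^esub> (inv\<^bsub>?F\<^esub> g \<otimes>\<^bsub>?F\<^esub> (inv\<^bsub>?F\<^esub> letter x \<otimes>\<^bsub>?F\<^esub> letter y) \<otimes>\<^bsub>?F\<^esub> g) \<otimes>\<^bsub>?F\<^esub> h)"
        using eventually_nhdsin_topspace[of X x]
      proof eventually_elim
        case (elim y)
        then show ?case using g h x by (simp add: F.inv_mult_group F.m_assoc)
      qed
    qed
    then show "(\<lambda>x. N (inv\<^bsub>?F\<^esub> h \<otimes>\<^bsub>?F\<^esub> x \<otimes>\<^bsub>?F\<^esub> h)) \<in> {N. continuous_length X N}"
      using F.length_function_conj[OF N' h] by (simp add: continuous_length_def)
  qed
qed

lemma continuous_length_rounded_length: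
  assumes W: "1 \<le> W" and q: "continuous_map X euclideanreal q"
  shows "continuous_length X (rounded_length W q)"
  unfolding continuous_length_def
proof (intro conjI ballI)
  let ?F = "free_group (topspace X)"
  interpret F: group ?F by (rule group_free_group)
  show len: "length_function ?F (rounded_length W q)"
    by (rule length_function_rounded_length[OF W])
  fix g x assume g: "g \<in> carrier ?F" and x: "x \<in> topspace X"
  let ?N = "\<lambda>y. rounded_length W q (inv\<^bsub>?F\<^esub> g \<otimes>\<^bsub>?F\<^esub> (inv\<^bsub>?F\<^esub> letter x \<otimes>\<^bsub>?F\<^esub> letter y) \<otimes>\<^bsub>?F\<^esub> g)"
  let ?B = "\<lambda>y. W * (2 * length g + 2) * (3 * \<bar>q x - q y\<bar>)"
  have lim: "(q \<longlongrightarrow> q x) (nhdsin X x)" using continuous_map_imp_tendsto_nhdsin[OF q x] .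
  then have ev: "\<forall>\<^sub>F y in nhdsin X x. dist (q y) (q x) < 1/3" by (rule tendstoD) simp
  show "(?N \<longlongrightarrow> 0) (nhdsin X x)"
  proof (rule tendsto_sandwich)
    show "\<forall>\<^sub>F y in nhdsin X x. 0 \<le> ?N y"
      using eventually_nhdsin_topspace[of X x]
    proof eventually_elim
      case (elim y)
      show ?case
        using g x elim by (intro length_functionD(2)[OF len] F.m_closed F.inv_closed letter_closed)
    qed
    show "\<forall>\<^sub>F y in nhdsin X x. ?N y \<le> ?B y"
      using eventually_nhdsin_topspace[of X x] ev
    proof eventually_elim
      case (elim y)
      then show ?case
        by (intro rounded_length_conj_le[OF W g x]) (auto simp: dist_real_def abs_minus_commute)
    qed
    have "((\<lambda>y. W * (2 * length g + 2) * (3 * \<bar>q x - q y\<bar>)) \<longlongrightarrow> W * (2 * length g + 2) * (3 * \<bar>q x - q x\<bar>)) (nhdsin X x)"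
      by (intro tendsto_intros lim)
    then show "(?B \<longlongrightarrow> 0) (nhdsin X x)" by simp
  qed simp
qed

text \<open>By \<open>dom\<close>, letters near x have length at most 1 for all large n, uniformly
  in the letter. Hence a fixed word is eventually no longer than its number of letters, and the
  coefficients \<open>1 / 2 ^ n\<close> give convergence. Near x the conjugates are dominated by a
  geometric series, so Tannery's theorem permits the limit under the sum. Finitely many terms may be
  arbitrarily large.\<close>

lemma continuous_length_suminf:
  assumes N: "\<And>n. continuous_length X (N n)"
    and dom: "\<And>x. x \<in> topspace X \<Longrightarrow>
      \<forall>\<^sub>F (n, y) in sequentially \<times>\<^sub>F nhdsin X x. N n (letter y) \<le> 1"
  shows "w \<in> carrier (free_group (topspace X)) \<Longrightarrow> summable (\<lambda>n. N n w / 2 ^ n)"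
    and "continuous_length X (\<lambda>w. \<Sum>n. N n w / 2 ^ n)"
proof -
  let ?F = "free_group (topspace X)"
  interpret F: group ?F by (rule group_free_group)
  have len: "length_function ?F (N n)" for n using N by (simp add: continuous_length_def)
  \<comment> \<open>The filter \<open>nhdsin X x\<close> does not puncture neighbourhoods, so the
    property near x may be evaluated at x itself.\<close>
  have letter: "\<forall>\<^sub>F n in sequentially. N n (letter x) \<le> 1" if x: "x \<in> topspace X" for x
    using eventually_eventually_prod_filter1[OF dom[OF x]]
  proof eventually_elim
    case (elim n)
    then show ?case using x unfolding eventually_nhdsin by auto
  qed
  have ev: "\<forall>\<^sub>F n in sequentially. N n w \<le> length w" if "w \<in> carrier ?F" for w
    using that
  proof (induction w)
    case Nil
    then show ?case using length_functionD(1)[OF len] by (simp add: free_group_simps)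
  next
    case (Cons a w)
    note aw = free_group_Cons[OF Cons.prems]
    have a: "fst a \<in> topspace X" using aw(2) by (simp add: free_group_simps)
    show ?case using Cons.IH[OF aw(3)] letter[OF a]
    proof eventually_elim
      case (elim n)
      have "N n [a] = N n (letter (fst a))"
        using single_eq_letter[OF aw(2)] length_functionD(3)[OF len letter_closed[OF a]] by metis
      then show ?case
        using elim length_functionD(4)[OF len aw(2,3), of n] unfolding aw(1)[symmetric] by simp
    qed
  qed
  have geo: "summable (\<lambda>n. c / 2 ^ n)" for c :: real
    using summable_mult[OF summable_geometric[of "1/2::real"], of c]
    by (simp add: power_divide)
  show sum: "summable (\<lambda>n. N n w / 2 ^ n)" if w: "w \<in> carrier ?F" for w
  proof (rule summable_comparison_test_ev[OF _ geo[of "length w"]])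
    show "\<forall>\<^sub>F n in sequentially. norm (N n w / 2 ^ n) \<le> real (length w) / 2 ^ n"
      using ev[OF w]
    proof eventually_elim
      case (elim n)
      then show ?case using length_functionD(2)[OF len w, of n] by (simp add: divide_right_mono)
    qed
  qed
  have "length_function ?F (\<lambda>w. \<Sum>n. N n w / 2 ^ n)"
    unfolding length_function_def
  proof (intro conjI ballI)
    fix u v assume u: "u \<in> carrier ?F" and v: "v \<in> carrier ?F"
    have "(\<Sum>n. N n (u \<otimes>\<^bsub>?F\<^esub> v) / 2 ^ n) \<le> (\<Sum>n. N n u / 2 ^ n + N n v / 2 ^ n)"
    proof (rule suminf_le)
      show "N n (u \<otimes>\<^bsub>?F\<^esub> v) / 2 ^ n \<le> N n u / 2 ^ n + N n v / 2 ^ n" for n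
        using length_functionD(4)[OF len u v, of n] unfolding add_divide_distrib[symmetric]
        by (intro divide_right_mono) auto
    qed (intro sum summable_add F.m_closed u v)+
    then show "(\<Sum>n. N n (u \<otimes>\<^bsub>?F\<^esub> v) / 2 ^ n) \<le> (\<Sum>n. N n u / 2 ^ n) + (\<Sum>n. N n v / 2 ^ n)"
      using suminf_add[OF sum[OF u] sum[OF v]] by simp
  next
    fix u assume u: "u \<in> carrier ?F"
    show "0 \<le> (\<Sum>n. N n u / 2 ^ n)"
      by (intro suminf_nonneg sum u) (simp add: length_functionD(2)[OF len u])
  qed (simp_all add: length_functionD(1,3)[OF len])
  moreover have "((\<lambda>y. \<Sum>n. N n (inv\<^bsub>?F\<^esub> g \<otimes>\<^bsub>?F\<^esub> (inv\<^bsub>?F\<^esub> letter x \<otimes>\<^bsub>?F\<^esub> letter y) \<otimes>\<^bsub>?F\<^esub> g) / 2 ^ n)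
      \<longlongrightarrow> 0) (nhdsin X x)" if g: "g \<in> carrier ?F" and x: "x \<in> topspace X" for g x
  proof -
    let ?z = "\<lambda>y. inv\<^bsub>?F\<^esub> g \<otimes>\<^bsub>?F\<^esub> (inv\<^bsub>?F\<^esub> letter x \<otimes>\<^bsub>?F\<^esub> letter y) \<otimes>\<^bsub>?F\<^esub> g"
    let ?C = "2 * real (length g) + 2"
    have nb: "nhdsin X x \<noteq> bot"
      using x by (auto simp: trivial_limit_def eventually_nhdsin)
    have "((\<lambda>y. N n (?z y) / 2 ^ n) \<longlongrightarrow> 0) (nhdsin X x)" for n
      using tendsto_divide_zero[where c = "2 ^ n"] N g x unfolding continuous_length_def by blast
    moreover have "\<forall>\<^sub>F (n, y) in sequentially \<times>\<^sub>F nhdsin X x. norm (N n (?z y) / 2 ^ n) \<le> ?C / 2 ^ n"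
    proof -
      have "\<forall>\<^sub>F (n, y) in sequentially \<times>\<^sub>F nhdsin X x. N n g \<le> length g"
        using ev[OF g] nb by (simp add: eventually_prod1)
      moreover have "\<forall>\<^sub>F (n, y) in sequentially \<times>\<^sub>F nhdsin X x. N n (letter x) \<le> 1"
        using letter[OF x] nb by (simp add: eventually_prod1)
      moreover have "\<forall>\<^sub>F (n, y) in sequentially \<times>\<^sub>F nhdsin X x. y \<in> topspace X"
        using eventually_nhdsin_topspace[of X x] by (simp add: eventually_prod2)
      ultimately show ?thesis using dom[OF x]
      proof eventually_elim
        case (elim p)
        obtain n y where p: "p = (n, y)" by (cases p)
        have cl: "letter x \<in> carrier ?F" "letter y \<in> carrier ?F" using elim p x by auto
        have "N n (inv\<^bsub>?F\<^esub> letter x \<otimes>\<^bsub>?F\<^esub> letter y) \<le> 2"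
          using length_functionD(4)[OF len F.inv_closed[OF cl(1)] cl(2), of n]
            length_functionD(3)[OF len cl(1), of n] elim p by simp
        then have "N n (?z y) \<le> ?C"
          using F.length_function_conj_le[OF len g, of "inv\<^bsub>?F\<^esub> letter x \<otimes>\<^bsub>?F\<^esub> letter y" n]
            elim p cl by simp
        moreover have "0 \<le> N n (?z y)"
          using g cl by (intro length_functionD(2)[OF len] F.m_closed F.inv_closed)
        ultimately show ?case using p by (simp add: divide_right_mono)
      qed
    qed
    ultimately show ?thesis
      using tannerys_theorem[where a = "\<lambda>n y. N n (?z y) / 2 ^ n" and b = "\<lambda>_. 0" and F = "nhdsin X x"] geo nb
      by auto
  qed
  ultimately show "continuous_length X (\<lambda>w. \<Sum>n. N n w / 2 ^ n)"
    by (simp add: continuous_length_def)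
qed

text \<open>Tietze extension gives p with values at least 1 that is injective and integral on Z.
  Complete regularity gives f with f x = 0 that equals 1 on the rest of Z and outside U. Subtracting
  from p a bump of height p x at x, built from f, lowers the value at x to 0 and changes nothing
  else on Z or outside U.\<close>

lemma integral_separation:
  assumes X: "completely_regular_space X" "Hausdorff_space X"
    and Z: "finite Z" "Z \<subseteq> topspace X" and U: "openin X U" and x: "x \<in> Z" "x \<in> U"
  obtains q where "continuous_map X euclideanreal q" "inj_on q Z" "\<And>z. z \<in> Z \<Longrightarrow> q z \<in> \<int>"
    "q x = 0" "\<And>y. y \<in> topspace X - U \<Longrightarrow> 1 \<le> q y"
proof -
  obtain c :: "'a \<Rightarrow> nat" where c: "inj_on c Z"
    using finite_imp_inj_to_nat_seg[OF Z(1)] by blast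
  have "subtopology X Z = discrete_topology Z"
    using Z finite_t1_space_imp_discrete_topology[of "subtopology X Z" Z]
      Hausdorff_imp_t1_space[OF Hausdorff_space_subtopology[OF X(2)]] by (simp add: inf.absorb2)
  \<comment> \<open>The shift by one keeps the prescribed values, and with them the range of the
    extension, inside \<open>{1..}\<close>.\<close>
  then have cont: "continuous_map (subtopology X Z) euclideanreal (\<lambda>z. real (c z) + 1)" by simp
  have ne: "{1::real..} \<noteq> {}" and im: "(\<lambda>z. real (c z) + 1) ` Z \<subseteq> {1..}" by auto
  obtain p where p: "continuous_map X euclideanreal p" "p ` topspace X \<subseteq> {1..}"
    "\<And>z. z \<in> Z \<Longrightarrow> p z = real (c z) + 1"
    by (rule Tietze_extension_completely_regular[OF X(1) finite_imp_compactin[OF Z(2,1)] is_interval_ci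
        ne cont im]) blast
  have "closedin X ((topspace X - U) \<union> (Z - {x}))"
    using U Z X(2) by (intro closedin_Un closedin_diff closedin_topspace closedin_Hausdorff_finite) auto
  moreover have "x \<in> topspace X - ((topspace X - U) \<union> (Z - {x}))" using x Z by auto
  ultimately obtain f :: "'a \<Rightarrow> real" where f: "continuous_map X (top_of_set {0..1}) f" "f x = 0"
    "f ` ((topspace X - U) \<union> (Z - {x})) \<subseteq> {1}"
    using X(1) unfolding completely_regular_space_def by meson
  define q where "q y = p y - p x * (1 - f y)" for y
  have q: "q y = p y" if "y \<in> (topspace X - U) \<union> (Z - {x})" for y
    using f(3) that by (force simp: q_def)
  have "continuous_map X euclideanreal q"
    unfolding q_def using f(1) p(1)
    by (intro continuous_intros) (auto simp: continuous_map_in_subtopology)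
  moreover have qx: "q x = 0" by (simp add: q_def f(2))
  moreover have "inj_on q Z"
  proof (rule inj_onI)
    fix y z assume yz: "y \<in> Z" "z \<in> Z" "q y = q z"
    have *: "q v = (if v = x then 0 else real (c v) + 1)" if "v \<in> Z" for v
      using that q[of v] qx p(3) by auto
    show "y = z" using yz c unfolding inj_on_def by (auto simp: * split: if_splits)
  qed
  moreover have "q z \<in> \<int>" if "z \<in> Z" for z
    using q[of z] qx p(3)[of z] that by (cases "z = x") auto
  moreover have "1 \<le> q y" if "y \<in> topspace X - U" for y
    using q[of y] p(2) that by auto
  ultimately show thesis using that by blast
qed

lemma integral_injection:
  assumes X: "completely_regular_space X" "Hausdorff_space X" and Z: "finite Z" "Z \<subseteq> topspace X"
  shows "\<exists>q. continuous_map X euclideanreal q \<and> inj_on q Z \<and> (\<forall>z\<in>Z. q z \<in> \<int>)"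
proof (cases "Z = {}")
  case True
  then show ?thesis by (intro exI[of _ "\<lambda>_. 0"]) auto
next
  case False
  then obtain x where x: "x \<in> Z" "x \<in> topspace X" using Z by blast
  obtain q where "continuous_map X euclideanreal q" "inj_on q Z" "\<And>z. z \<in> Z \<Longrightarrow> q z \<in> \<int>"
    by (rule integral_separation[OF X Z openin_topspace x]) blast
  then show ?thesis by blast
qed

section \<open>Compact sets in the free topological group\<close>

text \<open>\<open>cont_coord\<close> carries compactness from \<open>T\<close> to the length
  topology, where length functions are bounded; \<open>lift_coord\<close> makes \<Phi> injective and
  evaluates coordinate words back in G.\<close>

locale free_coordinates =
  fixes X :: "'a topology" and G :: "'g monoid" and T :: "'g topology"
    and i :: "'a \<Rightarrow> 'g" and \<Phi> :: "'g \<Rightarrow> ('a \<times> bool) list"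
  assumes regular: "completely_regular_space X" and Hausdorff: "Hausdorff_space X"
    and top_group: "topological_group G T"
    and cont_i: "continuous_map X T i"
    and hom_coord: "\<Phi> \<in> hom G (free_group (topspace X))"
    and cont_coord: "continuous_map T (length_topology (free_group (topspace X)) {N. continuous_length X N}) \<Phi>"
    and coord_i: "x \<in> topspace X \<Longrightarrow> \<Phi> (i x) = letter x"
    and lift_coord: "g \<in> carrier G \<Longrightarrow> free_lift G i (\<Phi> g) = g"

text \<open>With weight 1 and a function q that is injective and integral on the letters of w,
  nothing cancels, so the rounded length is at least the number of letters.\<close>

lemma continuous_length_separates:
  assumes X: "completely_regular_space X" "Hausdorff_space X"
    and w: "w \<in> carrier (free_group (topspace X))" "w \<noteq> []"
  shows "\<exists>N. continuous_length X N \<and> N w > 0"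
proof -
  have "fst ` set w \<subseteq> topspace X" using w(1) by (simp add: free_group_simps)
  from integral_injection[OF X finite_imageI[OF List.finite_set] this]
  obtain q where q: "continuous_map X euclideanreal q" "inj_on q (fst ` set w)"
    "\<And>z. z \<in> fst ` set w \<Longrightarrow> q z \<in> \<int>"
    by blast
  have eq: "rounded_length 1 q w = word_weight (\<lambda>x. label_weight 1 (round (q x))) w"
    using q(3) by (intro rounded_length_integral[OF _ w(1) q(2)]) auto
  have "real (length w) \<le> rounded_length 1 q w"
    unfolding eq by (rule word_weight_ge_length) (simp add: label_weight_def)
  moreover have "0 < length w" using w(2) by simp
  ultimately have "0 < rounded_length 1 q w" by linarith
  then show ?thesis using continuous_length_rounded_length[OF order_refl q(1)] by blast
qed

text \<open>The map \<open>letter\<close> is continuous into a Hausdorff topological group and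
  therefore extends to \<Phi>. Evaluation after \<Phi> is a homomorphism fixing the image of i,
  which generates G, so it is the identity.\<close>

lemma free_topological_group_coordinates:
  fixes X :: "'a topology" and G :: "'g monoid"
  assumes X: "completely_regular_space X" "Hausdorff_space X"
    and free: "free_topological_group X G T i"
  obtains \<Phi> where "free_coordinates X G T i \<Phi>"
proof -
  let ?F = "free_group (topspace X)" and ?N = "{N. continuous_length X N}"
  interpret F: length_family ?F ?N by (rule length_family_continuous_length)
  have G: "topological_group G T" and i: "continuous_map X T i"
    using free by (auto simp: free_topological_group_def)
  interpret G: group G using G by (simp add: topological_group_def)
  have iX: "i ` topspace X \<subseteq> carrier G"
    using i G by (auto simp: continuous_map_def topological_group_def)
  have H: "Hausdorff_space (length_topology ?F ?N)"
    using continuous_length_separates[OF X]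
    by (intro F.Hausdorff_length_topology) (auto simp: free_group_simps(3))
  have cont: "continuous_map X (length_topology ?F ?N) letter"
    unfolding F.continuous_map_length_topology
  proof (intro conjI ballI allI impI)
    fix x N and e :: real assume x: "x \<in> topspace X" and N: "N \<in> ?N" and e: "e > 0"
    have one: "\<one>\<^bsub>?F\<^esub> \<in> carrier ?F" by simp
    have "\<forall>\<^sub>F y in nhdsin X x. dist (N (inv\<^bsub>?F\<^esub> \<one>\<^bsub>?F\<^esub> \<otimes>\<^bsub>?F\<^esub>
        (inv\<^bsub>?F\<^esub> letter x \<otimes>\<^bsub>?F\<^esub> letter y) \<otimes>\<^bsub>?F\<^esub> \<one>\<^bsub>?F\<^esub>)) 0 < e"
      using N one x e unfolding mem_Collect_eq continuous_length_def by (intro tendstoD) blast+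
    then have "\<forall>\<^sub>F y in nhdsin X x. N (inv\<^bsub>?F\<^esub> letter x \<otimes>\<^bsub>?F\<^esub> letter y) < e"
      using eventually_nhdsin_topspace[of X x]
    proof eventually_elim
      case (elim y)
      then show ?case using x by simp
    qed
    then show "\<exists>V. openin X V \<and> x \<in> V \<and> (\<forall>y\<in>V. N (inv\<^bsub>?F\<^esub> letter x \<otimes>\<^bsub>?F\<^esub> letter y) < e)"
      using x unfolding eventually_nhdsin by blast
  qed auto
  obtain \<Phi> where \<Phi>: "\<Phi> \<in> hom G ?F" "continuous_map T (length_topology ?F ?N) \<Phi>"
    "\<And>x. x \<in> topspace X \<Longrightarrow> \<Phi> (i x) = letter x"
    using free_topological_group_factor[OF free F.topological_group_length_topology H cont] by blast
  have "(free_lift G i \<circ> \<Phi>) g = (\<lambda>x. x) g" if g: "g \<in> carrier G" for g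
  proof (rule hom_eq_on_generate[OF G.is_group G.is_group _ _ iX])
    show "free_lift G i \<circ> \<Phi> \<in> hom G G"
      using hom_compose[OF \<Phi>(1) G.free_lift_hom[OF iX]] .
    show "g \<in> generate G (i ` topspace X)"
      using free_topological_group_generate[OF free] g by simp
    show "(free_lift G i \<circ> \<Phi>) b = b" if b: "b \<in> i ` topspace X" for b
      using b iX \<Phi>(3) by (auto simp: free_lift_letter G.is_group)
  qed (auto simp: hom_def)
  then have "free_coordinates X G T i \<Phi>"
    using X G i \<Phi> by (simp add: free_coordinates_def)
  then show thesis using that by blast
qed

context free_coordinates
begin

sublocale F: length_family "free_group (topspace X)" "{N. continuous_length X N}"
  by (rule length_family_continuous_length)

sublocale G: group G
  using top_group by (simp add: topological_group_def)

lemma coord_closed: "g \<in> carrier G \<Longrightarrow> \<Phi> g \<in> carrier (free_group (topspace X))"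
  using hom_coord by (auto simp: hom_def)

lemma topspace_T: "topspace T = carrier G"
  using top_group by (simp add: topological_group_def)

lemma compactin_subset_carrier: "compactin T K \<Longrightarrow> K \<subseteq> carrier G"
  using compactin_subset_topspace topspace_T by blast

lemma i_closed: "x \<in> topspace X \<Longrightarrow> i x \<in> carrier G"
  using cont_i topspace_T by (auto simp: continuous_map_def)

lemma continuous_length_bounded:
  assumes "compactin T K" "continuous_length X N"
  shows "\<exists>B. \<forall>g\<in>K. N (\<Phi> g) \<le> B"
  using F.compactin_length_bounded[of N "\<Phi> ` K"] image_compactin[OF assms(1) cont_coord] assms(2)
  by auto

text \<open>The n-th rounded length is adapted to the word of \<open>g n\<close>, where nothing
  cancels, so it equals the weight there. The sum with coefficients \<open>1 / 2 ^ n\<close> is a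
  continuous length, hence bounded on K, and it dominates each of its terms. By \<open>dom\<close>,
  near a given point only finitely many n allow a letter the large weight.\<close>

lemma weights_bounded:
  assumes K: "compactin T K" and g: "\<And>n. g n \<in> K"
    and W: "\<And>n. 1 \<le> W n" and q: "\<And>n. continuous_map X euclideanreal (q n)"
    and inj: "\<And>n. inj_on (q n) (fst ` set (\<Phi> (g n)))"
    and int: "\<And>n z. z \<in> fst ` set (\<Phi> (g n)) \<Longrightarrow> q n z \<in> \<int>"
    and dom: "\<And>x. x \<in> topspace X \<Longrightarrow>
      \<forall>\<^sub>F (n, y) in sequentially \<times>\<^sub>F nhdsin X x. W n = 1 \<or> 1 \<le> q n y"
  shows "\<exists>B. \<forall>n. word_weight (\<lambda>x. label_weight (W n) (round (q n x))) (\<Phi> (g n)) \<le> B * 2 ^ n"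
proof -
  let ?N = "\<lambda>n. rounded_length (W n) (q n)"
  have cl: "\<Phi> (g n) \<in> carrier (free_group (topspace X))" for n
    using coord_closed g compactin_subset_carrier[OF K] by blast
  have N: "continuous_length X (?N n)" for n
    by (rule continuous_length_rounded_length[OF W q])
  have dom': "\<forall>\<^sub>F (n, y) in sequentially \<times>\<^sub>F nhdsin X x. ?N n (letter y) \<le> 1" if x: "x \<in> topspace X" for x
    using dom[OF x]
  proof eventually_elim
    case (elim p)
    then show ?case using rounded_length_letter_le_1[OF W[of "fst p"], of "q (fst p)" "snd p"]
      by (simp add: case_prod_unfold)
  qed
  obtain B where B: "\<And>h. h \<in> K \<Longrightarrow> (\<Sum>n. ?N n (\<Phi> h) / 2 ^ n) \<le> B"
    using continuous_length_bounded[OF K continuous_length_suminf(2)[OF N dom']] by blast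
  have "?N n (\<Phi> (g n)) / 2 ^ n \<le> B" for n
  proof -
    have "0 \<le> ?N k (\<Phi> (g n))" for k
      by (rule length_functionD(2)[OF length_function_rounded_length[OF W] cl])
    then have "(\<Sum>k\<in>{n}. ?N k (\<Phi> (g n)) / 2 ^ k) \<le> (\<Sum>k. ?N k (\<Phi> (g n)) / 2 ^ k)"
      by (intro sum_le_suminf continuous_length_suminf(1)[OF N dom'] cl) auto
    then show ?thesis using B[OF g[of n]] by simp
  qed
  then have "?N n (\<Phi> (g n)) \<le> B * 2 ^ n" for n by (simp add: divide_le_eq)
  moreover have "?N n (\<Phi> (g n)) = word_weight (\<lambda>x. label_weight (W n) (round (q n x))) (\<Phi> (g n))" for n
    by (intro rounded_length_integral[OF W cl inj] int)
  ultimately show ?thesis by metis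
qed

lemma length_coord_bounded:
  assumes K: "compactin T K"
  shows "\<exists>m. \<forall>g\<in>K. length (\<Phi> g) \<le> m"
proof (rule ccontr)
  assume "\<not> ?thesis"
  \<comment> \<open>The factor \<open>2 ^ n\<close> offsets the coefficient of the n-th length
    function; the remaining factor n outgrows every bound.\<close>
  then have "\<exists>g. g \<in> K \<and> n * 2 ^ n < length (\<Phi> g)" for n by (meson not_le)
  then obtain g where g: "\<And>n. g n \<in> K" "\<And>n. n * 2 ^ n < length (\<Phi> (g n))" by metis
  have "fst ` set (\<Phi> (g n)) \<subseteq> topspace X" for n
    using coord_closed[of "g n"] g(1)[of n] compactin_subset_carrier[OF K] by (auto simp: free_group_simps)
  then have "\<exists>q. continuous_map X euclideanreal q \<and> inj_on q (fst ` set (\<Phi> (g n))) \<and>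
      (\<forall>z \<in> fst ` set (\<Phi> (g n)). q z \<in> \<int>)" for n
    by (intro integral_injection regular Hausdorff) auto
  then obtain q where q: "\<And>n. continuous_map X euclideanreal (q n)"
    "\<And>n. inj_on (q n) (fst ` set (\<Phi> (g n)))" "\<And>n z. z \<in> fst ` set (\<Phi> (g n)) \<Longrightarrow> q n z \<in> \<int>"
    by metis
  obtain B where B: "\<And>n. word_weight (\<lambda>x. label_weight 1 (round (q n x))) (\<Phi> (g n)) \<le> B * 2 ^ n"
  proof -
    have "\<exists>B. \<forall>n. word_weight (\<lambda>x. label_weight 1 (round (q n x))) (\<Phi> (g n)) \<le> B * 2 ^ n"
      by (rule weights_bounded[OF K g(1) _ q]) (auto simp: case_prod_unfold)
    then show thesis using that by blast
  qed
  obtain n :: nat where n: "B < real n" using reals_Archimedean2 by blast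
  have "real (length (\<Phi> (g n))) \<le> word_weight (\<lambda>x. label_weight 1 (round (q n x))) (\<Phi> (g n))"
    by (rule word_weight_ge_length) (simp add: label_weight_def)
  also have "\<dots> \<le> B * 2 ^ n" by (rule B)
  also have "\<dots> \<le> real (n * 2 ^ n)" using n by simp
  finally show False using g(2)[of n] by linarith
qed

text \<open>Without compactness, Bolzano-Weierstrass gives infinitely many image points of letters
  with no limit point. The letters \<open>x n\<close> over them then have locally finite
  neighbourhoods \<open>U n\<close>, so each may receive a weight \<open>W n\<close> growing faster
  than \<open>weights_bounded\<close> permits.\<close>

lemma support_relatively_compact:
  assumes K: "compactin T K" and Y: "metrizable_space Y" and p: "continuous_map X Y p"
  shows "compactin Y (Y closure_of (p ` (\<Union>g\<in>K. fst ` set (\<Phi> g))))"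
proof (rule ccontr)
  assume nc: "\<not> ?thesis"
  obtain M d where "Metric_space M d" and Yd: "Y = Metric_space.mtopology M d"
    using Y by (auto simp: metrizable_space_def)
  interpret Metric_space M d by fact
  obtain S where S: "infinite S" "S \<subseteq> p ` (\<Union>g\<in>K. fst ` set (\<Phi> g))" "S \<subseteq> M"
    "mtopology derived_set_of S = {}"
    using nc unfolding Yd compact_closure_of_eq_Bolzano_Weierstrass by blast
  obtain y :: "nat \<Rightarrow> _" where y: "inj y" "range y \<subseteq> S"
    using infinite_countable_subset[OF S(1)] by blast
  have "\<exists>g x. g \<in> K \<and> x \<in> fst ` set (\<Phi> g) \<and> p x = y n" for n
  proof -
    have "y n \<in> p ` (\<Union>g\<in>K. fst ` set (\<Phi> g))" using y(2) S(2) by (meson rangeI subsetD)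
    then obtain x where x: "y n = p x" "x \<in> (\<Union>g\<in>K. fst ` set (\<Phi> g))" by (rule imageE)
    from x(2) obtain g where "g \<in> K" "x \<in> fst ` set (\<Phi> g)" by (rule UN_E)
    with x(1) show ?thesis by (intro exI[of _ g] exI[of _ x]) simp
  qed
  then obtain g x where gx: "\<And>n. g n \<in> K" "\<And>n. x n \<in> fst ` set (\<Phi> (g n))" "\<And>n. p (x n) = y n"
    by metis
  \<comment> \<open>The radii tend to 0 so that small balls about a set without limit points form a
    locally finite family.\<close>
  define U where "U n = {v \<in> topspace X. p v \<in> mball (y n) (1 / (real n + 1))}" for n
  have Z: "fst ` set (\<Phi> (g n)) \<subseteq> topspace X" for n
    using coord_closed[of "g n"] gx(1)[of n] compactin_subset_carrier[OF K] by (auto simp: free_group_simps)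
  have U: "openin X (U n)" "x n \<in> U n" for n
  proof -
    show "openin X (U n)"
      unfolding U_def by (rule openin_continuous_map_preimage[OF p]) (simp add: Yd)
    have "y n \<in> M" using y(2) S(3) by blast
    then show "x n \<in> U n" using Z[of n] gx(2)[of n] gx(3)[of n] by (auto simp: U_def)
  qed
  have "\<exists>q. continuous_map X euclideanreal q \<and> inj_on q (fst ` set (\<Phi> (g n))) \<and>
      (\<forall>z \<in> fst ` set (\<Phi> (g n)). q z \<in> \<int>) \<and> q (x n) = 0 \<and> (\<forall>v \<in> topspace X - U n. 1 \<le> q v)" for n
    by (rule integral_separation[OF regular Hausdorff finite_imageI[OF List.finite_set] Z[of n] U(1)[of n]
        gx(2)[of n] U(2)[of n]]) blast
  then obtain q where q: "\<And>n. continuous_map X euclideanreal (q n)"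
    "\<And>n. inj_on (q n) (fst ` set (\<Phi> (g n)))" "\<And>n z. z \<in> fst ` set (\<Phi> (g n)) \<Longrightarrow> q n z \<in> \<int>"
    "\<And>n. q n (x n) = 0" "\<And>n v. v \<in> topspace X - U n \<Longrightarrow> 1 \<le> q n v"
    by metis
  \<comment> \<open>The factor \<open>2 ^ n\<close> cancels the coefficient in the sum, and n + 1
    exceeds any constant.\<close>
  define W :: "nat \<Rightarrow> real" where "W n = (real n + 1) * 2 ^ n" for n
  have W: "1 \<le> W n" for n
    using mult_mono[of 1 "real n + 1" 1 "2 ^ n"] by (simp add: W_def)
  have dom: "\<forall>\<^sub>F (n, v) in sequentially \<times>\<^sub>F nhdsin X z. W n = 1 \<or> 1 \<le> q n v"
    if z: "z \<in> topspace X" for z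
  proof -
    \<comment> \<open>Since S has no limit point, some ball about p z of radius e contains no point
      of S except possibly p z.\<close>
    have pz: "p z \<in> M" using p z Yd by (auto simp: continuous_map_def)
    then obtain e where e: "e > 0" "\<And>v. v \<in> S \<Longrightarrow> v \<in> mball (p z) e \<Longrightarrow> v = p z"
      using S(4) unfolding metric_derived_set_of by blast
    \<comment> \<open>The point p z may itself be one of the \<open>y n\<close>, but by injectivity
      for one index at most.\<close>
    have "\<forall>\<^sub>F n in sequentially. y n \<noteq> p z"
    proof (cases "\<exists>m. y m = p z")
      case True
      then obtain m where m: "y m = p z" by blast
      then have "y n \<noteq> p z" if "n > m" for n using that injD[OF y(1), of n m] by auto
      then show ?thesis by (intro eventually_sequentiallyI[of "Suc m"]) auto
    qed auto
    moreover have "\<forall>\<^sub>F n in sequentially. 1 / (real n + 1) < e / 2"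
    proof -
      have "(\<lambda>n. 1 / (real n + 1)) \<longlonglongrightarrow> 0"
        using LIMSEQ_inverse_real_of_nat by (simp add: divide_inverse add.commute)
      then show ?thesis using e(1) by (intro order_tendstoD(2)) auto
    qed
    ultimately have "\<forall>\<^sub>F n in sequentially. y n \<noteq> p z \<and> 1 / (real n + 1) < e / 2"
      by (rule eventually_conj)
    moreover have "\<forall>\<^sub>F v in nhdsin X z. v \<in> topspace X \<and> p v \<in> mball (p z) (e / 2)"
      unfolding eventually_nhdsin
    proof (intro disjI2 exI conjI ballI)
      show "openin X {v \<in> topspace X. p v \<in> mball (p z) (e / 2)}"
        by (rule openin_continuous_map_preimage[OF p]) (simp add: Yd)
    qed (use z pz e in auto)
    moreover have "1 \<le> q n v"
      if n: "y n \<noteq> p z \<and> 1 / (real n + 1) < e / 2" and v: "v \<in> topspace X \<and> p v \<in> mball (p z) (e / 2)" for n v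
    proof (rule q(5))
      have "p v \<notin> mball (y n) (1 / (real n + 1))"
      proof
        assume a: "p v \<in> mball (y n) (1 / (real n + 1))"
        then have "d (p z) (y n) < e"
          using v n triangle[of "p z" "p v" "y n"] commute[of "p v" "y n"] by auto
        then have "y n \<in> mball (p z) e" using a pz by auto
        then show False using e(2)[of "y n"] y(2) n by auto
      qed
      then show "v \<in> topspace X - U n" using v by (simp add: U_def)
    qed
    ultimately show ?thesis unfolding eventually_prod_filter by fastforce
  qed
  obtain B where B: "\<And>n. word_weight (\<lambda>x. label_weight (W n) (round (q n x))) (\<Phi> (g n)) \<le> B * 2 ^ n"
    using weights_bounded[OF K gx(1) W q(1,2,3) dom] by blast
  obtain n :: nat where n: "B < real n" using reals_Archimedean2 by blast
  have "W n = label_weight (W n) (round (q n (x n)))" by (simp add: q(4) label_weight_def)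
  also have "\<dots> \<le> word_weight (\<lambda>x. label_weight (W n) (round (q n x))) (\<Phi> (g n))"
    using label_weight_nonneg[OF W] by (intro word_weight_ge[OF _ gx(2)])
  also have "\<dots> \<le> B * 2 ^ n" by (rule B)
  finally show False using n by (simp add: W_def)
qed

end

section \<open>Covering the tree of reduced words\<close>

text \<open>For a reduced word this is the shortest element of its left coset modulo the subgroup
  generated by A; it names the tree of the word metric in which the word lies.\<close>

definition word_core :: "'a set \<Rightarrow> ('a \<times> bool) list \<Rightarrow> ('a \<times> bool) list" where
  "word_core A w = rev (dropWhile (\<lambda>a. fst a \<in> A) (rev w))"

text \<open>
  Words are grouped by their level \<open>k\<close> in annuli of width \<open>R\<close> and by their initial segment up to the
  preceding annulus, prolonged if necessary so that only letters of \<open>A\<close> follow. For \<open>k = 0\<close> the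
  truncated subtraction gives level \<open>0\<close>, as it should.
\<close>

definition annulus_key :: "'a set \<Rightarrow> nat \<Rightarrow> ('a \<times> bool) list \<Rightarrow> nat \<times> ('a \<times> bool) list" where
  "annulus_key A R w = (length w div R,
     take (max ((length w div R - 1) * R) (length (word_core A w))) w)"

lemma word_core_append: "fst ` set s \<subseteq> A \<Longrightarrow> word_core A (p @ s) = word_core A p"
  unfolding word_core_def rev_append by (subst dropWhile_append2) auto

lemma length_word_core_le: "length (word_core A w) \<le> length w"
  by (simp add: word_core_def) (metis length_dropWhile_le length_rev)

lemma fst_set_drop_core:
  assumes "length (word_core A w) \<le> c"
  shows "fst ` set (drop c w) \<subseteq> A"
proof -
  let ?P = "\<lambda>a :: 'a \<times> bool. fst a \<in> A"
  have "w = rev (takeWhile ?P (rev w) @ dropWhile ?P (rev w))" by simp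
  then have w: "w = word_core A w @ rev (takeWhile ?P (rev w))"
    unfolding word_core_def by (simp only: rev_append)
  have "drop c w = drop (c - length (word_core A w)) (rev (takeWhile ?P (rev w)))"
    by (subst w) (use assms in simp)
  then have "set (drop c w) \<subseteq> set (takeWhile ?P (rev w))"
    by (metis set_drop_subset set_rev)
  then show ?thesis by (auto dest: set_takeWhileD)
qed

text \<open>Multiplication by u changes at most the last R letters, so the level changes by at most
  one, and equal parity forces equal levels. The prefix kept in the key ends before the part that is
  changed: the previous annulus begins at least R letters before the end, and only letters of A are
  exchanged.\<close>

lemma annulus_key_near:
  assumes red: "is_reduced w" "is_reduced u" and u: "fst ` set u \<subseteq> A" "length u \<le> R" and R: "0 < R"
    and par: "length w div R mod 2 = length (foldr push w u) div R mod 2"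
  shows "annulus_key A R w = annulus_key A R (foldr push w u)"
proof -
  obtain p s t where p: "w = p @ s" "u = word_inv s @ t" "foldr push w u = p @ t"
    using foldr_push_decomp[OF red] by blast
  let ?w' = "foldr push w u"
  have A: "fst ` set s \<subseteq> A" "fst ` set t \<subseteq> A"
    using u(1) unfolding p(2) by (simp_all add: image_Un)
  have st: "length s + length t \<le> R" using u(2) p(2) by simp
  have "length w div R \<le> (length ?w' + R) div R" "length ?w' div R \<le> (length w + R) div R"
    using st p by (auto intro!: div_le_mono)
  then have "length w div R \<le> length ?w' div R + 1" "length ?w' div R \<le> length w div R + 1"
    using R by auto
  moreover have "b = a" if "a \<le> b + 1" "b \<le> a + 1" "a mod 2 = b mod 2" for a b :: nat
    using that by presburger
  ultimately have k: "length ?w' div R = length w div R" using par by blast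
  let ?k = "length w div R"
  have "?k * R \<le> length w" by (rule div_times_less_eq_dividend)
  then have "(?k - 1) * R \<le> length w - R"
    unfolding diff_mult_distrib mult_1 by (rule diff_le_mono)
  also have "\<dots> \<le> length p" using st p(1) by simp
  finally have "(?k - 1) * R \<le> length p" .
  then have c: "max ((?k - 1) * R) (length (word_core A p)) \<le> length p"
    using length_word_core_le by auto
  have core: "word_core A w = word_core A p" "word_core A ?w' = word_core A p"
    using A p by (simp_all add: word_core_append)
  show ?thesis
    unfolding annulus_key_def k core using c p by simp
qed

text \<open>The kept prefix reaches at least to the start of the preceding annulus, so fewer than
  two annuli follow it, and it contains the core, so only letters of A follow it.\<close>

lemma annulus_key_eqD:
  assumes key: "annulus_key A R w = annulus_key A R w'" and R: "0 < R"
  obtains p s t where "w = p @ s" "w' = p @ t" "fst ` set s \<subseteq> A" "fst ` set t \<subseteq> A"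
    "length s \<le> 2 * R" "length t \<le> 2 * R"
proof -
  let ?k = "length w div R"
  define c where "c = max ((?k - 1) * R) (length (word_core A w))"
  define c' where "c' = max ((?k - 1) * R) (length (word_core A w'))"
  have k: "length w' div R = ?k" and tk: "take c w = take c' w'"
    using key by (auto simp: annulus_key_def c_def c'_def)
  have short: "length v - max ((?k - 1) * R) n \<le> 2 * R" if "length v div R = ?k" for v :: "('a \<times> bool) list" and n
  proof -
    have "length v < (?k + 1) * R"
      using that R by (metis add.commute dividend_less_times_div mult.commute plus_1_eq_Suc mult_Suc)
    \<comment> \<open>For level 0 the truncated subtraction gives 0, and the inequality reads R at
      most 2 R.\<close>
    also have "\<dots> \<le> (?k - 1) * R + 2 * R" by (cases ?k) (auto simp: algebra_simps)
    finally show ?thesis by linarith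
  qed
  show thesis
  proof (rule that)
    show "w = take c w @ drop c w" by simp
    show "w' = take c w @ drop c' w'" unfolding tk by simp
    show "fst ` set (drop c w) \<subseteq> A" "fst ` set (drop c' w') \<subseteq> A"
      by (rule fst_set_drop_core; simp add: c_def c'_def)+
    show "length (drop c w) \<le> 2 * R" "length (drop c' w') \<le> 2 * R"
      using short[of w] short[of w'] k by (auto simp: c_def c'_def)
  qed
qed

lemma length_foldr_push: "length (foldr push u v) \<le> length u + length v"
proof (induction u)
  case (Cons a u)
  have "length (push a w) \<le> Suc (length w)" for w by (cases w) auto
  then show ?case using Cons order_trans by fastforce
qed simp

lemma (in group) free_lift_append:
  assumes "f ` fst ` set u \<subseteq> carrier G" "f ` fst ` set v \<subseteq> carrier G"
  shows "free_lift G f (u @ v) = free_lift G f u \<otimes> free_lift G f v"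
  using assms by (induction u) (auto simp: m_assoc free_lift_closed)

section \<open>The two bounds on the asymptotic dimension\<close>

context free_coordinates
begin

lemma compactin_words:
  assumes A: "compactin X A"
  shows "\<exists>K. compactin T K \<and> (\<forall>w. length w \<le> n \<and> fst ` set w \<subseteq> A \<longrightarrow> free_lift G i w \<in> K)"
proof (induction n)
  case 0
  then show ?case by (intro exI[of _ "{\<one>\<^bsub>G\<^esub>}"]) (simp add: topspace_T)
next
  case (Suc n)
  then obtain K where K: "compactin T K"
    "\<And>w. length w \<le> n \<Longrightarrow> fst ` set w \<subseteq> A \<Longrightarrow> free_lift G i w \<in> K" by blast
  let ?m = "\<lambda>(x, y). x \<otimes>\<^bsub>G\<^esub> y"
  let ?B = "i ` A \<union> (\<lambda>x. inv\<^bsub>G\<^esub> x) ` i ` A"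
  have "compactin T (i ` A)" by (rule image_compactin[OF A cont_i])
  moreover from this have "compactin T ((\<lambda>x. inv\<^bsub>G\<^esub> x) ` i ` A)"
    using image_compactin top_group unfolding topological_group_def by blast
  ultimately have "compactin (prod_topology T T) (?B \<times> K)"
    using K(1) by (simp add: compactin_Times compactin_Un)
  then have "compactin T (?m ` (?B \<times> K))"
    using image_compactin top_group unfolding topological_group_def by blast
  then have "compactin T (K \<union> ?m ` (?B \<times> K))" using K(1) by (rule compactin_Un[rotated])
  moreover have "free_lift G i w \<in> K \<union> ?m ` (?B \<times> K)" if w: "length w \<le> Suc n" "fst ` set w \<subseteq> A" for w
  proof (cases w)
    case Nil
    then show ?thesis using K(2)[of "[]"] by simp
  next
    case (Cons a v)
    then have "free_lift G i v \<in> K" "fst a \<in> A" using K(2)[of v] w by auto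
    then have "?m (if snd a then i (fst a) else inv\<^bsub>G\<^esub> i (fst a), free_lift G i v) \<in> ?m ` (?B \<times> K)"
      by (intro imageI) auto
    then show ?thesis using Cons by simp
  qed
  ultimately show ?case by blast
qed

text \<open>Two L-related elements differ by right multiplication with a short word over one compact
  set A, which keeps the annulus key if the levels have equal parity. So the key classes of even
  level and those of odd level are the two disjoint families. Members of a class share a prefix
  followed by boundedly many letters of A, and such endings lie in a compact set by
  \<open>compactin_words\<close>.\<close>

lemma asdim_le_1:
  assumes supp: "\<And>K. compactin T K \<Longrightarrow> \<exists>A. compactin X A \<and> (\<Union>g\<in>K. fst ` set (\<Phi> g)) \<subseteq> A"
  shows "asdim_le (carrier G) (group_compact_coarse G T) 1"
  unfolding asdim_le_def
proof
  fix L assume "L \<in> group_compact_coarse G T"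
  then obtain K where K: "compactin T K"
    and L: "L \<subseteq> {(g \<otimes>\<^bsub>G\<^esub> a, g \<otimes>\<^bsub>G\<^esub> b) | g a b. g \<in> carrier G \<and> a \<in> K \<and> b \<in> K}"
    unfolding group_compact_coarse_def by blast
  obtain m where m: "\<And>g. g \<in> K \<Longrightarrow> length (\<Phi> g) \<le> m" using length_coord_bounded[OF K] by blast
  obtain A where A: "compactin X A" "(\<Union>g\<in>K. fst ` set (\<Phi> g)) \<subseteq> A" using supp[OF K] by blast
  have AX: "A \<subseteq> topspace X" using compactin_subset_topspace[OF A(1)] .
  let ?F = "free_group (topspace X)"
  \<comment> \<open>The words of a^-1 b with a and b in K have at most 2 m letters; the extra one
    makes R positive even for m = 0.\<close>
  define R where "R = 2 * m + 1"
  have R: "0 < R" by (simp add: R_def)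
  obtain K' where K': "compactin T K'"
    "\<And>w. length w \<le> 2 * R \<Longrightarrow> fst ` set w \<subseteq> A \<Longrightarrow> free_lift G i w \<in> K'"
    using compactin_words[OF A(1), of "2 * R"] by blast
  define cls where "cls \<kappa> = {g \<in> carrier G. annulus_key A R (\<Phi> g) = \<kappa>}" for \<kappa>
  define \<U> where "\<U> j = cls ` {\<kappa>. fst \<kappa> mod 2 = j}" for j :: nat
  have near: "annulus_key A R (\<Phi> g) = annulus_key A R (\<Phi> h)"
    if gh: "(g, h) \<in> L" and par: "length (\<Phi> g) div R mod 2 = length (\<Phi> h) div R mod 2" for g h
  proof -
    obtain k a b where kab: "g = k \<otimes>\<^bsub>G\<^esub> a" "h = k \<otimes>\<^bsub>G\<^esub> b" "k \<in> carrier G" "a \<in> K" "b \<in> K"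
      using gh L by auto
    have ab: "a \<in> carrier G" "b \<in> carrier G" using kab compactin_subset_carrier[OF K] by auto
    interpret \<Phi>: group_hom G ?F \<Phi>
      using hom_coord by (simp add: group_hom_def group_hom_axioms_def)
    let ?u = "foldr push (word_inv (\<Phi> a)) (\<Phi> b)"
    have cl: "\<Phi> a \<in> carrier ?F" "\<Phi> b \<in> carrier ?F" "\<Phi> g \<in> carrier ?F"
      using ab kab by (auto intro: coord_closed)
    have "h = g \<otimes>\<^bsub>G\<^esub> (inv\<^bsub>G\<^esub> a \<otimes>\<^bsub>G\<^esub> b)"
      using kab(1-3) ab by (simp add: G.m_assoc) (metis G.inv_closed G.m_assoc G.r_inv G.l_one)
    then have "\<Phi> h = \<Phi> g \<otimes>\<^bsub>?F\<^esub> (inv\<^bsub>?F\<^esub> \<Phi> a \<otimes>\<^bsub>?F\<^esub> \<Phi> b)"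
      using ab kab(1,3) by simp
    then have h: "\<Phi> h = foldr push (\<Phi> g) ?u"
      using cl(1) by (simp add: inv_free_group) (simp add: free_group_simps)
    have red: "is_reduced (\<Phi> g)" "is_reduced ?u"
      using cl by (auto simp: free_group_simps foldr_push_reduced)
    have "fst ` set ?u \<subseteq> fst ` set (\<Phi> a) \<union> fst ` set (\<Phi> b)"
      using image_mono[OF set_foldr_push[of "word_inv (\<Phi> a)" "\<Phi> b"], of fst] by (simp add: image_Un)
    then have u: "fst ` set ?u \<subseteq> A" using A(2) kab(4,5) by blast
    have "length ?u \<le> length (\<Phi> a) + length (\<Phi> b)"
      using length_foldr_push[of "word_inv (\<Phi> a)" "\<Phi> b"] by simp
    then have "length ?u \<le> R" using m[OF kab(4)] m[OF kab(5)] by (simp add: R_def)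
    then show ?thesis
      unfolding h using par unfolding h by (intro annulus_key_near[OF red u _ R])
  qed
  show "\<exists>\<U> :: nat \<Rightarrow> 'g set set.
        (\<Union>i\<le>1. \<Union>(\<U> i)) = carrier G \<and>
        (\<forall>i\<le>1. \<forall>A\<in>\<U> i. \<forall>B\<in>\<U> i. A \<noteq> B \<longrightarrow> (A \<times> B) \<inter> L = {}) \<and>
        (\<exists>M\<in>group_compact_coarse G T. \<forall>i\<le>1. \<forall>A\<in>\<U> i. A \<times> A \<subseteq> M)"
  proof (intro exI[of _ \<U>] conjI)
    show "(\<Union>j\<le>1. \<Union>(\<U> j)) = carrier G"
    proof
      show "(\<Union>j\<le>1. \<Union>(\<U> j)) \<subseteq> carrier G" by (auto simp: \<U>_def cls_def)
      show "carrier G \<subseteq> (\<Union>j\<le>1. \<Union>(\<U> j))"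
      proof
        fix g assume "g \<in> carrier G"
        then have "g \<in> cls (annulus_key A R (\<Phi> g))" by (simp add: cls_def)
        moreover have "cls (annulus_key A R (\<Phi> g)) \<in> \<U> (fst (annulus_key A R (\<Phi> g)) mod 2)"
          by (simp add: \<U>_def)
        moreover have "fst (annulus_key A R (\<Phi> g)) mod 2 \<le> 1" by auto
        ultimately show "g \<in> (\<Union>j\<le>1. \<Union>(\<U> j))" by blast
      qed
    qed
    show "\<forall>j\<le>1. \<forall>C\<in>\<U> j. \<forall>D\<in>\<U> j. C \<noteq> D \<longrightarrow> (C \<times> D) \<inter> L = {}"
    proof (intro allI impI ballI equals0I)
      fix j C D p assume CD: "C \<in> \<U> j" "D \<in> \<U> j" "C \<noteq> D" and p: "p \<in> (C \<times> D) \<inter> L"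
      obtain g h where gh: "p = (g, h)" "g \<in> C" "h \<in> D" "(g, h) \<in> L" using p by auto
      have *: "E = cls (annulus_key A R (\<Phi> k)) \<and> length (\<Phi> k) div R mod 2 = j"
        if E: "E \<in> \<U> j" "k \<in> E" for E k
      proof -
        obtain \<kappa> where \<kappa>: "E = cls \<kappa>" "fst \<kappa> mod 2 = j" using E(1) by (auto simp: \<U>_def)
        then have "\<kappa> = annulus_key A R (\<Phi> k)" using E(2) by (simp add: cls_def)
        then show ?thesis using \<kappa> by (simp add: annulus_key_def)
      qed
      have "C = cls (annulus_key A R (\<Phi> g))" "length (\<Phi> g) div R mod 2 = j"
        "D = cls (annulus_key A R (\<Phi> h))" "length (\<Phi> h) div R mod 2 = j"
        using *[OF CD(1) gh(2)] *[OF CD(2) gh(3)] by auto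
      then show False using near[OF gh(4)] CD(3) by simp
    qed
    let ?M = "{(g \<otimes>\<^bsub>G\<^esub> a, g \<otimes>\<^bsub>G\<^esub> b) | g a b. g \<in> carrier G \<and> a \<in> K' \<and> b \<in> K'}"
    show "\<exists>M\<in>group_compact_coarse G T. \<forall>j\<le>1. \<forall>C\<in>\<U> j. C \<times> C \<subseteq> M"
    proof (intro bexI[of _ ?M] allI impI ballI subsetI)
      show "?M \<in> group_compact_coarse G T" using K'(1) unfolding group_compact_coarse_def by blast
      fix j C p assume "C \<in> \<U> j" "p \<in> C \<times> C"
      then obtain g h where gh: "p = (g, h)" "g \<in> carrier G" "h \<in> carrier G"
        "annulus_key A R (\<Phi> g) = annulus_key A R (\<Phi> h)" by (auto simp: \<U>_def cls_def)
      obtain q s t where q: "\<Phi> g = q @ s" "\<Phi> h = q @ t" "fst ` set s \<subseteq> A" "fst ` set t \<subseteq> A"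
        "length s \<le> 2 * R" "length t \<le> 2 * R"
        using annulus_key_eqD[OF gh(4) R] by blast
      have "fst ` set q \<subseteq> topspace X" using coord_closed[OF gh(2)] q(1) by (auto simp: free_group_simps)
      then have i: "i ` fst ` set q \<subseteq> carrier G" "i ` fst ` set s \<subseteq> carrier G" "i ` fst ` set t \<subseteq> carrier G"
        using q(3,4) AX i_closed by blast+
      have "g = free_lift G i q \<otimes>\<^bsub>G\<^esub> free_lift G i s" "h = free_lift G i q \<otimes>\<^bsub>G\<^esub> free_lift G i t"
        using lift_coord[OF gh(2)] lift_coord[OF gh(3)] q(1,2) i by (simp_all add: G.free_lift_append)
      moreover have "free_lift G i s \<in> K'" "free_lift G i t \<in> K'" using K'(2) q by auto
      ultimately show "p \<in> ?M" using gh(1) G.free_lift_closed[OF i(1)] by blast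
    qed
  qed
qed

text \<open>Let L be the entourage of the compact set consisting of the identity and one generator.
  Consecutive powers of the generator are L-related, so a single L-disjoint family has one member
  containing all of them. Their word lengths are unbounded, against uniform boundedness.\<close>

lemma not_asdim_le_0:
  assumes "topspace X \<noteq> {}"
  shows "\<not> asdim_le (carrier G) (group_compact_coarse G T) 0"
proof
  assume asdim: "asdim_le (carrier G) (group_compact_coarse G T) 0"
  let ?F = "free_group (topspace X)"
  interpret \<Phi>: group_hom G ?F \<Phi>
    using hom_coord by (simp add: group_hom_def group_hom_axioms_def)
  obtain x where x: "x \<in> topspace X" using assms by blast
  let ?x = "i x"
  have xG: "?x \<in> carrier G" using i_closed[OF x] .
  let ?L = "{(g \<otimes>\<^bsub>G\<^esub> a, g \<otimes>\<^bsub>G\<^esub> b) | g a b. g \<in> carrier G \<and> a \<in> {\<one>\<^bsub>G\<^esub>, ?x} \<and> b \<in> {\<one>\<^bsub>G\<^esub>, ?x}}"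
  have "compactin T {\<one>\<^bsub>G\<^esub>, ?x}" using xG topspace_T by (intro finite_imp_compactin) auto
  then have L: "?L \<in> group_compact_coarse G T" unfolding group_compact_coarse_def by blast
  obtain \<U> :: "nat \<Rightarrow> 'g set set" and M where cov: "\<Union>(\<U> 0) = carrier G"
    and dis: "\<And>A B. A \<in> \<U> 0 \<Longrightarrow> B \<in> \<U> 0 \<Longrightarrow> A \<noteq> B \<Longrightarrow> (A \<times> B) \<inter> ?L = {}"
    and M: "M \<in> group_compact_coarse G T" "\<And>A. A \<in> \<U> 0 \<Longrightarrow> A \<times> A \<subseteq> M"
    using asdim[unfolded asdim_le_def, rule_format, OF L] by auto
  obtain A where A: "A \<in> \<U> 0" "\<one>\<^bsub>G\<^esub> \<in> A" 
    using G.one_closed cov by (metis UnionE)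
  have pow: "?x [^]\<^bsub>G\<^esub> n \<in> A" for n :: nat
  proof (induction n)
    case (Suc n)
    have "?x [^]\<^bsub>G\<^esub> Suc n \<in> carrier G" using xG by blast
    then obtain B where B: "B \<in> \<U> 0" "?x [^]\<^bsub>G\<^esub> Suc n \<in> B" using cov by blast
    have "(?x [^]\<^bsub>G\<^esub> n \<otimes>\<^bsub>G\<^esub> \<one>\<^bsub>G\<^esub>, ?x [^]\<^bsub>G\<^esub> n \<otimes>\<^bsub>G\<^esub> ?x) \<in> ?L" using xG by blast
    then have "(?x [^]\<^bsub>G\<^esub> n, ?x [^]\<^bsub>G\<^esub> Suc n) \<in> ?L" using xG by (simp add: G.nat_pow_Suc)
    with Suc B(2) have mem: "(?x [^]\<^bsub>G\<^esub> n, ?x [^]\<^bsub>G\<^esub> Suc n) \<in> (A \<times> B) \<inter> ?L" by (intro IntI SigmaI)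
    have "A = B"
    proof (rule ccontr)
      assume ne: "A \<noteq> B"
      from mem show False unfolding dis[OF A(1) B(1) ne] by (rule emptyE)
    qed
    then show ?case using B(2) by simp
  qed (use A in simp)
  have len: "\<Phi> (?x [^]\<^bsub>G\<^esub> n) = replicate n (x, True)" for n :: nat
  proof (induction n)
    case 0
    then show ?case using \<Phi>.hom_one by (simp add: free_group_simps)
  next
    case (Suc n)
    have "is_reduced (replicate k (x, True))" for k
    proof (induction k)
      case (Suc k)
      then show ?case by (cases k) (auto simp: flip_def)
    qed simp
    from this[of "Suc n"] have red: "is_reduced (replicate n (x, True) @ [(x, True)])"
      by (simp add: replicate_append_same)
    have "\<Phi> (?x [^]\<^bsub>G\<^esub> Suc n) = foldr push (replicate n (x, True)) [(x, True)]"
      using Suc xG coord_i[OF x] by (simp add: free_group_simps(2) letter_def)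
    then show ?case using foldr_push_append_reduced[OF red] by (simp add: replicate_append_same)
  qed
  obtain K where K: "compactin T K"
    "M \<subseteq> {(g \<otimes>\<^bsub>G\<^esub> a, g \<otimes>\<^bsub>G\<^esub> b) | g a b. g \<in> carrier G \<and> a \<in> K \<and> b \<in> K}"
    using M(1) unfolding group_compact_coarse_def by blast
  obtain m where m: "\<And>g. g \<in> K \<Longrightarrow> length (\<Phi> g) \<le> m" using length_coord_bounded[OF K(1)] by blast
  \<comment> \<open>If the identity and a power are g a and g b with a and b in K, the power is a^-1
    b and has at most 2 m letters.\<close>
  have "(\<one>\<^bsub>G\<^esub>, ?x [^]\<^bsub>G\<^esub> (2 * m + 1)) \<in> M" using M(2)[OF A(1)] A(2) pow by blast
  then obtain g a b where gab: "\<one>\<^bsub>G\<^esub> = g \<otimes>\<^bsub>G\<^esub> a" "?x [^]\<^bsub>G\<^esub> (2 * m + 1) = g \<otimes>\<^bsub>G\<^esub> b"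
    "g \<in> carrier G" "a \<in> K" "b \<in> K" using K(2) by auto
  have ab: "a \<in> carrier G" "b \<in> carrier G" using gab compactin_subset_carrier[OF K(1)] by auto
  have "g = inv\<^bsub>G\<^esub> a" using gab(1,3) ab by (metis G.inv_equality)
  then have "\<Phi> (?x [^]\<^bsub>G\<^esub> (2 * m + 1)) = inv\<^bsub>?F\<^esub> \<Phi> a \<otimes>\<^bsub>?F\<^esub> \<Phi> b"
    using gab(2) ab by simp
  then have "replicate (2 * m + 1) (x, True) = foldr push (word_inv (\<Phi> a)) (\<Phi> b)"
    unfolding len using coord_closed[OF ab(1)] by (simp add: inv_free_group free_group_simps(2))
  then have "2 * m + 1 \<le> length (\<Phi> a) + length (\<Phi> b)"
    using length_foldr_push[of "word_inv (\<Phi> a)" "\<Phi> b"] by (metis length_replicate length_word_inv)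
  then show False using m[OF gab(4)] m[OF gab(5)] by linarith
qed

end


section \<open>Closed subspaces of products of metrizable spaces\<close>

theorem theorem4p3:
  fixes X :: "'a topology"
    and M :: "'i \<Rightarrow> 'b topology" and I :: "'i set" and C :: "('i \<Rightarrow> 'b) set"
    and G :: "'g monoid" and T :: "'g topology" and i :: "'a \<Rightarrow> 'g"
  assumes "topspace X \<noteq> {}"
    and "\<And>j. j \<in> I \<Longrightarrow> metrizable_space (M j)"
    and "closedin (product_topology M I) C"
    and "X homeomorphic_space subtopology (product_topology M I) C"
    and "free_topological_group X G T i"
  shows "asdim_group G T = 1"
proof -
  let ?P = "product_topology M I"
  have "completely_regular_space ?P"
    using assms(2) metrizable_imp_completely_regular_space
    by (auto simp: completely_regular_space_product_topology)
  then have reg: "completely_regular_space X"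
    using homeomorphic_completely_regular_space[OF assms(4)] completely_regular_space_subtopology by blast
  have "Hausdorff_space ?P"
    using assms(2) metrizable_imp_Hausdorff_space by (auto simp: Hausdorff_space_product_topology)
  then have "Hausdorff_space X"
    using homeomorphic_Hausdorff_space[OF assms(4)] Hausdorff_space_subtopology by blast
  then obtain \<Phi> where "free_coordinates X G T i \<Phi>"
    using free_topological_group_coordinates[OF reg _ assms(5)] by blast
  then interpret free_coordinates X G T i \<Phi> .
  obtain f f' where ff: "homeomorphic_maps X (subtopology ?P C) f f'"
    using assms(4) unfolding homeomorphic_space_def by blast
  then have f: "continuous_map X ?P f" "continuous_map (subtopology ?P C) X f'"
    "\<And>x. x \<in> topspace X \<Longrightarrow> f x \<in> C" "\<And>x. x \<in> topspace X \<Longrightarrow> f' (f x) = x"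
    by (auto simp: homeomorphic_maps_def continuous_map_in_subtopology)
  have "\<exists>A. compactin X A \<and> (\<Union>g\<in>K. fst ` set (\<Phi> g)) \<subseteq> A" if K: "compactin T K" for K
  proof -
    let ?S = "\<Union>g\<in>K. fst ` set (\<Phi> g)"
    \<comment> \<open>Each coordinate of the support is relatively compact in its metrizable factor.
      By Tychonoff the product of the closures is compact; its intersection with the closed set C
      stays compact and can be carried back to X.\<close>
    define Q where "Q j = M j closure_of ((\<lambda>x. f x j) ` ?S)" for j
    have SX: "?S \<subseteq> topspace X"
    proof (rule UN_least)
      show "fst ` set (\<Phi> g) \<subseteq> topspace X" if "g \<in> K" for g
        using coord_closed[of g] compactin_subset_carrier[OF K] that by (auto simp: free_group_simps)
    qed
    have proj: "continuous_map X (M j) (\<lambda>x. f x j)" if "j \<in> I" for j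
      using f(1) that by (simp add: continuous_map_componentwise)
    have "compactin (M j) (Q j)" if "j \<in> I" for j
      unfolding Q_def by (rule support_relatively_compact[OF K assms(2)[OF that] proj[OF that]])
    then have "compactin ?P (PiE I Q)" by (simp add: compactin_PiE)
    then have "compactin ?P (PiE I Q \<inter> C)" using assms(3) by (rule compact_Int_closedin)
    then have "compactin (subtopology ?P C) (PiE I Q \<inter> C)" by (simp add: compactin_subtopology)
    then have "compactin X (f' ` (PiE I Q \<inter> C))" using image_compactin[OF _ f(2)] by blast
    moreover have "?S \<subseteq> f' ` (PiE I Q \<inter> C)"
    proof
      fix x assume x: "x \<in> ?S"
      then have xX: "x \<in> topspace X" using SX by blast
      have "f x j \<in> Q j" if "j \<in> I" for j
      proof -
        have "(\<lambda>x. f x j) ` ?S \<subseteq> topspace (M j)"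
          using proj[OF that] SX by (auto simp: continuous_map_def)
        from closure_of_subset[OF this] show ?thesis unfolding Q_def using x by blast
      qed
      moreover have "f x \<in> extensional I"
        using f(1) xX by (auto simp: continuous_map_def PiE_def)
      ultimately have "f x \<in> PiE I Q \<inter> C" using f(3)[OF xX] by (auto simp: PiE_def)
      then show "x \<in> f' ` (PiE I Q \<inter> C)" using f(4)[OF xX] by (metis imageI)
    qed
    ultimately show ?thesis by blast
  qed
  then have "asdim_le (carrier G) (group_compact_coarse G T) 1"
    by (rule asdim_le_1)
  moreover have "\<not> asdim_le (carrier G) (group_compact_coarse G T) 0"
    using assms(1) by (rule not_asdim_le_0)
  ultimately have "(LEAST n. asdim_le (carrier G) (group_compact_coarse G T) n) = 1"
    by (intro Least_equality) (auto simp: Suc_le_eq intro: gr0I)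
  then show ?thesis
    using \<open>asdim_le (carrier G) (group_compact_coarse G T) 1\<close>
    by (auto simp: asdim_group_def asdim_def one_enat_def)
qed

end
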